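(* For every $0\le\varepsilon\le1$, the following set of three experimental equations in a one-qubit CPSO variable $\mathbf{G}$ is $(\varepsilon,4579\sqrt{\varepsilon})$-robust: $$\mathrm{Pr}^0[\mathbf{G}(|0\rangle\langle0|)]=\tfrac12,\qquad \mathrm{Pr}^0[\mathbf{G}^2(|0\rangle\langle0|)]=1,\qquad \mathrm{Pr}^0[\mathbf{G}^2(|1\rangle\langle1|)]=0.$$
   Context: A one-qubit density matrix is a positive semidefinite Hermitian $2\times2$ matrix of trace $1$. A one-qubit superoperator is a linear map on $\mathbb{C}^{2\times2}$; a superoperator is a PSO if it sends density matrices to density matrices; $\mathbf{G}$ is a CPSO if $\mathbf{G}\otimes\mathbf{I}_M$ is a PSO for every positive integer $M$, where $\mathbf{I}_M$ is the identity on $\mathbb{C}^{M\times M}$. $\mathrm{Pr}^0[\rho]=\langle0|\rho|0\rangle$. An experimental equation (one qubit, one variable) is an equation $\mathrm{Pr}^0[\mathbf{G}^k(|b\rangle\langle b|)]=r$ in the unknown one-qubit CPSO $\mathbf{G}$, where $k$ is a non-negative integer, $b\in\{0,1\}$ and $0\le r\le1$. $\mathbf{G}$ $\varepsilon$-satisfies it if $|\mathrm{Pr}^0[\mathbf{G}^k(|b\rangle\langle b|)]-r|\le\varepsilon$, and satisfies it if this holds with $\varepsilon=0$. $\mathbf{G}$ ($\varepsilon$-)satisfies a finite set $(E)$ of such equations if it ($\varepsilon$-)satisfies each one. $(E)$ is satisfiable if some CPSO satisfies it; $\mathcal{F}_{(E)}$ is the set of all one-qubit CPSOs satisfying $(E)$.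 $\|V\|_1=\mathrm{Tr}\sqrt{V^\dagger V}$, $\|\mathbf{G}\|_\infty=\sup\{\|\mathbf{G}(V)\|_1:\|V\|_1=1\}$ for a superoperator $\mathbf{G}$, and $\mathrm{dist}_\infty$ is the induced distance (distance to a set being the infimum). For $\varepsilon,\delta\ge0$, a finite satisfiable $(E)$ is $(\varepsilon,\delta)$-robust if every CPSO $\mathbf{G}$ that $\varepsilon$-satisfies $(E)$ has $\mathrm{dist}_\infty(\mathbf{G},\mathcal{F}_{(E)})\le\delta$. *)

theory Defs
  imports Complex_Main "Jordan_Normal_Form.Schur_Decomposition"
begin

definition mat_trace :: "complex mat \<Rightarrow> complex" where
  "mat_trace A = (\<Sum>i<dim_row A. A $$ (i, i))"

definition hermitian :: "complex mat \<Rightarrow> bool" where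
  "hermitian A \<longleftrightarrow> mat_adjoint A = A"

text \<open>The quadratic form of a Hermitian matrix is real, so taking its real part loses nothing.\<close>

definition psd :: "nat \<Rightarrow> complex mat \<Rightarrow> bool" where
  "psd n A \<longleftrightarrow> A \<in> carrier_mat n n \<and> hermitian A \<and>
     (\<forall>v \<in> carrier_vec n. Re ((A *\<^sub>v v) \<bullet>c v) \<ge> 0)"

definition density :: "nat \<Rightarrow> complex mat \<Rightarrow> bool" where
  "density n \<rho> \<longleftrightarrow> psd n \<rho> \<and> mat_trace \<rho> = 1"

text \<open>A superoperator is a function on all matrices of which only the restriction
  to the n-by-n matrices is meaningful; every notion below depends on that restriction alone.\<close>

definition superoperator :: "nat \<Rightarrow> (complex mat \<Rightarrow> complex mat) \<Rightarrow> bool" where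
  "superoperator n G \<longleftrightarrow>
     (\<forall>A \<in> carrier_mat n n. G A \<in> carrier_mat n n) \<and>
     (\<forall>A \<in> carrier_mat n n. \<forall>B \<in> carrier_mat n n. G (A + B) = G A + G B) \<and>
     (\<forall>c. \<forall>A \<in> carrier_mat n n. G (c \<cdot>\<^sub>m A) = c \<cdot>\<^sub>m G A)"

definition pso :: "nat \<Rightarrow> (complex mat \<Rightarrow> complex mat) \<Rightarrow> bool" where
  "pso n G \<longleftrightarrow> superoperator n G \<and> (\<forall>\<rho>. density n \<rho> \<longrightarrow> density n (G \<rho>))"

text \<open>\<open>ketbra n i j\<close> is the matrix unit \<open>|i\<rangle>\<langle>j|\<close>.\<close>

definition ketbra :: "nat \<Rightarrow> nat \<Rightarrow> nat \<Rightarrow> complex mat" where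
  "ketbra n i j = mat n n (\<lambda>(r, s). if r = i \<and> s = j then 1 else 0)"

definition kronecker :: "complex mat \<Rightarrow> complex mat \<Rightarrow> complex mat" where
  "kronecker A B = mat (dim_row A * dim_row B) (dim_col A * dim_col B)
     (\<lambda>(r, s). A $$ (r div dim_row B, s div dim_col B) * B $$ (r mod dim_row B, s mod dim_col B))"

text \<open>The tensor product of superoperators is determined by linearity and
  \<open>(G \<otimes> H)(A \<otimes> B) = G A \<otimes> H B\<close>: expand the argument \<open>X\<close> in the basis
  \<open>|i\<rangle>\<langle>j| \<otimes> |k\<rangle>\<langle>l|\<close>, whose coefficients are the entries of \<open>X\<close>.\<close>

definition tensor_superop ::
  "nat \<Rightarrow> nat \<Rightarrow> (complex mat \<Rightarrow> complex mat) \<Rightarrow> (complex mat \<Rightarrow> complex mat) \<Rightarrow>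
   complex mat \<Rightarrow> complex mat" where
  "tensor_superop m n G H X = mat (m * n) (m * n) (\<lambda>(r, s).
     \<Sum>i<m. \<Sum>j<m. \<Sum>k<n. \<Sum>l<n.
       X $$ (i * n + k, j * n + l) * kronecker (G (ketbra m i j)) (H (ketbra n k l)) $$ (r, s))"

definition cpso :: "nat \<Rightarrow> (complex mat \<Rightarrow> complex mat) \<Rightarrow> bool" where
  "cpso n G \<longleftrightarrow> superoperator n G \<and> (\<forall>M>0. pso (n * M) (tensor_superop n M G (\<lambda>A. A)))"

definition Pr0 :: "complex mat \<Rightarrow> real" where
  "Pr0 \<rho> = Re ((\<rho> *\<^sub>v unit_vec 2 0) \<bullet>c unit_vec 2 0)"

text \<open>\<open>Exp_Eq k b r\<close> is the equation \<open>Pr0 ((G ^^ k) |b\<rangle>\<langle>b|) = r\<close> in the unknown one-qubit \<open>G\<close>.\<close>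

datatype exp_eq = Exp_Eq (steps: nat) (init: nat) (prob: real)

definition valid_exp_eq :: "exp_eq \<Rightarrow> bool" where
  "valid_exp_eq e \<longleftrightarrow> init e \<in> {0, 1} \<and> 0 \<le> prob e \<and> prob e \<le> 1"

definition eps_satisfies :: "real \<Rightarrow> (complex mat \<Rightarrow> complex mat) \<Rightarrow> exp_eq set \<Rightarrow> bool" where
  "eps_satisfies \<epsilon> G E \<longleftrightarrow>
     (\<forall>e \<in> E. \<bar>Pr0 ((G ^^ steps e) (ketbra 2 (init e) (init e))) - prob e\<bar> \<le> \<epsilon>)"

definition solutions :: "exp_eq set \<Rightarrow> (complex mat \<Rightarrow> complex mat) set" where
  "solutions E = {G. cpso 2 G \<and> eps_satisfies 0 G E}"

definition satisfiable :: "exp_eq set \<Rightarrow> bool" where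
  "satisfiable E \<longleftrightarrow> (\<exists>G. cpso 2 G \<and> eps_satisfies 0 G E)"

definition psd_sqrt :: "nat \<Rightarrow> complex mat \<Rightarrow> complex mat" where
  "psd_sqrt n A = (THE S. psd n S \<and> S * S = A)"

definition trace_norm :: "nat \<Rightarrow> complex mat \<Rightarrow> real" where
  "trace_norm n V = Re (mat_trace (psd_sqrt n (mat_adjoint V * V)))"

definition superop_norm :: "nat \<Rightarrow> (complex mat \<Rightarrow> complex mat) \<Rightarrow> real" where
  "superop_norm n G = Sup {trace_norm n (G V) | V. V \<in> carrier_mat n n \<and> trace_norm n V = 1}"

definition superop_dist ::
  "nat \<Rightarrow> (complex mat \<Rightarrow> complex mat) \<Rightarrow> (complex mat \<Rightarrow> complex mat) \<Rightarrow> real" where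
  "superop_dist n G H = superop_norm n (\<lambda>V. G V - H V)"

definition superop_set_dist ::
  "nat \<Rightarrow> (complex mat \<Rightarrow> complex mat) \<Rightarrow> (complex mat \<Rightarrow> complex mat) set \<Rightarrow> real" where
  "superop_set_dist n G F = (INF H\<in>F. superop_dist n G H)"

definition robust :: "real \<Rightarrow> real \<Rightarrow> exp_eq set \<Rightarrow> bool" where
  "robust \<epsilon> \<delta> E \<longleftrightarrow>
     0 \<le> \<epsilon> \<and> 0 \<le> \<delta> \<and> finite E \<and> (\<forall>e \<in> E. valid_exp_eq e) \<and> satisfiable E \<and>
     (\<forall>G. cpso 2 G \<and> eps_satisfies \<epsilon> G E \<longrightarrow> superop_set_dist 2 G (solutions E) \<le> \<delta>)"

end

theory Submission
  imports Defs
begin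

text \<open>
  Write \<open>p, q\<close> for the \<open>(0,0)\<close> entries and \<open>c, d\<close> for the \<open>(0,1)\<close> entries of \<open>G |0\<rangle>\<langle>0|\<close> and \<open>G |1\<rangle>\<langle>1|\<close>,
  and \<open>x, y, z, -x\<close> for the entries of \<open>G |0\<rangle>\<langle>1|\<close>. The second and third equation, up to \<open>\<epsilon>\<close>, say that
  \<open>[(1-p)(1-q) - |x|\<^sup>2] + [p(1-p) - |c|\<^sup>2] + |x - cnj c|\<^sup>2 \<le> \<epsilon>\<close> and
  \<open>[pq - |x|\<^sup>2] + [q(1-q) - |d|\<^sup>2] + |x + cnj d|\<^sup>2 \<le> \<epsilon>\<close>, where all brackets are nonnegative, being
  2-by-2 minors of the Choi matrix of \<open>G\<close>. Hence \<open>q\<close>, \<open>c\<close>, \<open>d\<close>, \<open>x\<close> are within \<open>O(sqrt \<epsilon>)\<close> of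
  \<open>1/2\<close>, \<open>cnj w / 2\<close>, \<open>- cnj w / 2\<close>, \<open>w / 2\<close> with \<open>w = cnj c / |c|\<close>. The form of the Choi matrix
  is \<open>1 - 2|c| = O(\<epsilon>)\<close> at the vector \<open>e\<^sub>0\<^sub>1 - cnj w e\<^sub>0\<^sub>0\<close>, so the Cauchy-Schwarz inequality
  pins down \<open>y\<close> and \<open>z\<close> as well. The limit is conjugation by the unitary
  \<open>(1, cnj w; w, -1) / sqrt 2\<close>, an exact solution, and the distance obtained is \<open>48 sqrt \<epsilon>\<close>.
\<close>

section \<open>Adjoints, sesquilinear forms and traces of complex matrices\<close>

lemma dim_mat_adjoint [simp]:
  "dim_row (mat_adjoint A) = dim_col A" "dim_col (mat_adjoint A) = dim_row A"
  by (auto simp: mat_adjoint_def)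

lemma mat_adjoint_carrier [simp]:
  "A \<in> carrier_mat n m \<Longrightarrow> mat_adjoint A \<in> carrier_mat m n"
  by auto

lemma index_mat_adjoint [simp]:
  fixes A :: "complex mat"
  assumes "i < dim_col A" "j < dim_row A"
  shows "mat_adjoint A $$ (i, j) = cnj (A $$ (j, i))"
  using assms by (simp add: mat_adjoint_def mat_of_rows_index)

lemma mat_adjoint_adjoint [simp]: "mat_adjoint (mat_adjoint A) = A" for A :: "complex mat"
  by (rule eq_matI) auto

lemma mat_adjoint_mult:
  fixes A B :: "complex mat"
  assumes "A \<in> carrier_mat n m" "B \<in> carrier_mat m k"
  shows "mat_adjoint (A * B) = mat_adjoint B * mat_adjoint A"
  using assms by (intro eq_matI) (auto simp: scalar_prod_def mult.commute intro!: sum.cong)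

lemma cscalar_prod_mult_mat_vec_sum:
  fixes A :: "complex mat"
  assumes "A \<in> carrier_mat n m" "v \<in> carrier_vec m" "w \<in> carrier_vec n"
  shows "(A *\<^sub>v v) \<bullet>c w = (\<Sum>i<n. \<Sum>j<m. A $$ (i, j) * v $ j * cnj (w $ i))"
  using assms by (simp add: scalar_prod_def sum_distrib_right atLeast0LessThan)

lemma cscalar_prod_mult_mat_vec:
  fixes A :: "complex mat"
  assumes "A \<in> carrier_mat n m" "v \<in> carrier_vec m" "w \<in> carrier_vec n"
  shows "(A *\<^sub>v v) \<bullet>c w = v \<bullet>c (mat_adjoint A *\<^sub>v w)"
proof -
  have "(A *\<^sub>v v) \<bullet>c w = (\<Sum>i<n. \<Sum>j<m. A $$ (i, j) * v $ j * cnj (w $ i))"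
    by (rule cscalar_prod_mult_mat_vec_sum[OF assms])
  also have "\<dots> = (\<Sum>j<m. \<Sum>i<n. A $$ (i, j) * v $ j * cnj (w $ i))"
    by (rule sum.swap)
  also have "\<dots> = v \<bullet>c (mat_adjoint A *\<^sub>v w)"
    using assms by (simp add: scalar_prod_def sum_distrib_left atLeast0LessThan mult_ac)
  finally show ?thesis .
qed

lemma mat_trace_mult_commute:
  assumes "A \<in> carrier_mat n m" "B \<in> carrier_mat m n"
  shows "mat_trace (A * B) = mat_trace (B * A)"
proof -
  have "mat_trace (A * B) = (\<Sum>i<n. \<Sum>j<m. A $$ (i, j) * B $$ (j, i))"
    using assms by (simp add: mat_trace_def scalar_prod_def atLeast0LessThan)
  also have "\<dots> = (\<Sum>j<m. \<Sum>i<n. A $$ (i, j) * B $$ (j, i))"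
    by (rule sum.swap)
  also have "\<dots> = mat_trace (B * A)"
    using assms by (simp add: mat_trace_def scalar_prod_def atLeast0LessThan mult.commute)
  finally show ?thesis .
qed

section \<open>Positive semidefinite matrices and density matrices\<close>

lemma psd_carrier: "psd n A \<Longrightarrow> A \<in> carrier_mat n n"
  by (simp add: psd_def)

lemma psd_adjoint: "psd n A \<Longrightarrow> mat_adjoint A = A"
  by (simp add: psd_def hermitian_def)

lemma psd_index_cnj:
  assumes "psd n A" "i < n" "j < n"
  shows "A $$ (j, i) = cnj (A $$ (i, j))"
  using index_mat_adjoint[of j A i] assms psd_adjoint[OF assms(1)] psd_carrier[OF assms(1)] by simp

lemma psd_cscalar_prod_cnj:
  assumes "psd n A" "v \<in> carrier_vec n" "w \<in> carrier_vec n"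
  shows "(A *\<^sub>v w) \<bullet>c v = cnj ((A *\<^sub>v v) \<bullet>c w)"
proof -
  have A: "A \<in> carrier_mat n n" using psd_carrier[OF assms(1)] .
  have "(A *\<^sub>v w) \<bullet>c v = w \<bullet>c (A *\<^sub>v v)"
    using cscalar_prod_mult_mat_vec[OF A assms(3,2)] psd_adjoint[OF assms(1)] by simp
  also have "\<dots> = cnj ((A *\<^sub>v v) \<bullet>c w)"
    using assms A by (simp add: scalar_prod_def mult.commute)
  finally show ?thesis .
qed

text \<open>The form is nonnegative at \<open>v + t w\<close>. Taking \<open>t = s b\<close> with
  \<open>s\<close> real and \<open>b\<close> the mixed term turns the cross terms into
  \<open>2 s |b|^2\<close>, so a real quadratic in \<open>s\<close> is nonnegative everywhere. A
  semidefinite form may vanish at \<open>w\<close>, hence the separate case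
  \<open>c = 0\<close>.\<close>

lemma psd_Cauchy_Schwarz:
  assumes P: "psd n A" and v: "v \<in> carrier_vec n" and w: "w \<in> carrier_vec n"
  shows "(cmod ((A *\<^sub>v v) \<bullet>c w))\<^sup>2 \<le> Re ((A *\<^sub>v v) \<bullet>c v) * Re ((A *\<^sub>v w) \<bullet>c w)"
proof -
  define a b c where "a = Re ((A *\<^sub>v v) \<bullet>c v)" and "b = (A *\<^sub>v v) \<bullet>c w"
    and "c = Re ((A *\<^sub>v w) \<bullet>c w)"
  have A: "A \<in> carrier_mat n n" using psd_carrier[OF P] .
  have quad: "a + 2 * s * (cmod b)\<^sup>2 + s\<^sup>2 * (cmod b)\<^sup>2 * c \<ge> 0" for s :: real
  proof -
    define t where "t = of_real s * b"
    have "(A *\<^sub>v (v + t \<cdot>\<^sub>v w)) \<bullet>c (v + t \<cdot>\<^sub>v w) =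
        (A *\<^sub>v v) \<bullet>c v + cnj t * b + t * cnj b + t * cnj t * ((A *\<^sub>v w) \<bullet>c w)"
    proof -
      have "(A *\<^sub>v (v + t \<cdot>\<^sub>v w)) = A *\<^sub>v v + t \<cdot>\<^sub>v (A *\<^sub>v w)"
        using A v w by (simp add: mult_add_distrib_mat_vec[of _ n n] mult_mat_vec[of _ n n])
      moreover have "(x + t \<cdot>\<^sub>v y) \<bullet>c (v + t \<cdot>\<^sub>v w) =
          x \<bullet>c v + cnj t * (x \<bullet>c w) + t * (y \<bullet>c v) + t * cnj t * (y \<bullet>c w)"
        if "x \<in> carrier_vec n" "y \<in> carrier_vec n" for x y
        using that v w
        by (simp add: scalar_prod_def sum_distrib_left sum.distrib algebra_simps)
      ultimately show ?thesis
        using A v w psd_cscalar_prod_cnj[OF P v w] by (simp add: b_def)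
    qed
    moreover have "Re ((A *\<^sub>v (v + t \<cdot>\<^sub>v w)) \<bullet>c (v + t \<cdot>\<^sub>v w)) \<ge> 0"
      using P v w by (simp add: psd_def)
    moreover have "Re (cnj t * b + t * cnj b) = 2 * s * (cmod b)\<^sup>2"
      by (simp add: t_def cmod_power2) (simp add: power2_eq_square algebra_simps)
    moreover have "t * cnj t = of_real (s\<^sup>2 * (cmod b)\<^sup>2)"
      by (simp add: t_def complex_mult_cnj cmod_power2 complex_eq_iff)
        (simp add: power2_eq_square algebra_simps)
    ultimately show ?thesis by (simp add: a_def c_def del: of_real_mult)
  qed
  have "c \<ge> 0" using P w by (simp add: psd_def c_def)
  show ?thesis
  proof (cases "c = 0")
    case True
    have "(cmod b)\<^sup>2 = 0"
    proof (rule ccontr)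
      assume "(cmod b)\<^sup>2 \<noteq> 0"
      \<comment> \<open>For \<open>c = 0\<close> the quadratic is affine in \<open>s\<close>; this
        is the \<open>s\<close> at which it takes the value -1.\<close>
      then have "a + 2 * (- (a + 1) / (2 * (cmod b)\<^sup>2)) * (cmod b)\<^sup>2 = - 1"
        by (simp add: field_simps)
      with quad[of "- (a + 1) / (2 * (cmod b)\<^sup>2)"] True show False by simp
    qed
    with True show ?thesis by (simp add: b_def c_def)
  next
    case False
    \<comment> \<open>The quadratic attains its minimum at \<open>s = - 1 / c\<close>.\<close>
    have "a + 2 * (- 1 / c) * (cmod b)\<^sup>2 + (- 1 / c)\<^sup>2 * (cmod b)\<^sup>2 * c = a - (cmod b)\<^sup>2 / c"
      using False by (simp add: field_simps power2_eq_square)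
    with quad[of "- 1 / c"] have "a - (cmod b)\<^sup>2 / c \<ge> 0" by simp
    with False \<open>c \<ge> 0\<close> show ?thesis
      by (simp add: field_simps a_def b_def c_def)
  qed
qed

lemma psd_congruence:
  assumes X: "psd m X" and B: "B \<in> carrier_mat n m"
  shows "psd n (B * X * mat_adjoint B)"
proof -
  have Xc: "X \<in> carrier_mat m m" using psd_carrier[OF X] .
  have "mat_adjoint (B * X * mat_adjoint B) = B * mat_adjoint (B * X)"
    using B Xc mat_adjoint_mult[of "B * X" n m "mat_adjoint B" n] by simp
  also have "\<dots> = B * X * mat_adjoint B"
    using B Xc psd_adjoint[OF X] mat_adjoint_mult[OF B Xc]
    by (simp add: assoc_mult_mat[OF B Xc mat_adjoint_carrier[OF B]])
  finally have "mat_adjoint (B * X * mat_adjoint B) = B * X * mat_adjoint B" .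
  moreover have "Re ((B * X * mat_adjoint B *\<^sub>v v) \<bullet>c v) \<ge> 0" if v: "v \<in> carrier_vec n" for v
  proof -
    have "B * X * mat_adjoint B *\<^sub>v v = B *\<^sub>v (X *\<^sub>v (mat_adjoint B *\<^sub>v v))"
      using B Xc v assoc_mult_mat_vec[of "B * X" n m "mat_adjoint B" n v]
        assoc_mult_mat_vec[OF B Xc, of "mat_adjoint B *\<^sub>v v"]
      by (metis mat_adjoint_carrier mult_carrier_mat mult_mat_vec_carrier)
    then have "(B * X * mat_adjoint B *\<^sub>v v) \<bullet>c v =
        (X *\<^sub>v (mat_adjoint B *\<^sub>v v)) \<bullet>c (mat_adjoint B *\<^sub>v v)"
      using B Xc v cscalar_prod_mult_mat_vec[OF B, of "X *\<^sub>v (mat_adjoint B *\<^sub>v v)" v]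
      by (metis mat_adjoint_carrier mult_mat_vec_carrier)
    moreover have "mat_adjoint B *\<^sub>v v \<in> carrier_vec m"
      using B v by (intro mult_mat_vec_carrier[of _ m n]) auto
    ultimately show ?thesis using X by (simp add: psd_def)
  qed
  moreover have "B * X * mat_adjoint B \<in> carrier_mat n n"
    using B Xc by (metis mult_carrier_mat mat_adjoint_carrier)
  ultimately show ?thesis by (simp add: psd_def hermitian_def)
qed

text \<open>Cyclicity of the trace moves \<open>mat_adjoint B\<close> next to \<open>B\<close>,
  where the two cancel. A rectangular \<open>B\<close> is allowed, so that the same fact covers
  unitary conjugation and the preparation of a pure state from dimension one.\<close>

lemma density_isometry:
  assumes X: "density m X" and B: "B \<in> carrier_mat n m" and iso: "mat_adjoint B * B = 1\<^sub>m m"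
  shows "density n (B * X * mat_adjoint B)"
proof -
  have Xc: "X \<in> carrier_mat m m" using X by (simp add: density_def psd_def)
  have "mat_trace (B * X * mat_adjoint B) = mat_trace (mat_adjoint B * (B * X))"
    using B Xc by (intro mat_trace_mult_commute[of _ n m]) auto
  also have "mat_adjoint B * (B * X) = X"
    using B Xc iso by (simp flip: assoc_mult_mat[of _ m n _ m _ m])
  finally show ?thesis
    using X psd_congruence[OF _ B] by (simp add: density_def)
qed

section \<open>Kronecker products and ampliations\<close>

lemma sum_lessThan_mult:
  fixes f :: "nat \<Rightarrow> 'a :: comm_monoid_add"
  shows "(\<Sum>t<m * n. f t) = (\<Sum>i<m. \<Sum>k<n. f (i * n + k))"
proof -
  have "sum f {i * n..<i * n + n} = (\<Sum>k<n. f (i * n + k))" for i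
    using sum.shift_bounds_nat_ivl[of f 0 "i * n" n] by (simp add: add.commute atLeast0LessThan)
  then show ?thesis by (simp flip: sum.nat_group)
qed

lemma mult_add_less:
  fixes i k m n :: nat
  assumes "i < m" "k < n"
  shows "i * n + k < m * n"
proof -
  have "i * n + k < Suc i * n" using assms by simp
  also have "\<dots> \<le> m * n" using assms by (intro mult_le_mono1) simp
  finally show ?thesis .
qed

lemma dim_kronecker [simp]:
  "dim_row (kronecker A B) = dim_row A * dim_row B"
  "dim_col (kronecker A B) = dim_col A * dim_col B"
  by (simp_all add: kronecker_def)

lemma index_kronecker:
  assumes "i < dim_row A" "j < dim_col A" "k < dim_row B" "l < dim_col B"
  shows "kronecker A B $$ (i * dim_row B + k, j * dim_col B + l) = A $$ (i, j) * B $$ (k, l)"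
  using assms mult_add_less[of i "dim_row A" k "dim_row B"] mult_add_less[of j "dim_col A" l "dim_col B"]
  by (simp add: kronecker_def)
lemma index_mult_sum:
  assumes "A \<in> carrier_mat n m" "B \<in> carrier_mat m k" "i < n" "j < k"
  shows "(A * B) $$ (i, j) = (\<Sum>l<m. A $$ (i, l) * B $$ (l, j))"
  using assms by (simp add: scalar_prod_def atLeast0LessThan)

text \<open>Conjugation by this matrix is the tensor product of conjugation by \<open>U\<close> with
  the identity superoperator.\<close>

definition ampliation :: "nat \<Rightarrow> complex mat \<Rightarrow> complex mat" where
  "ampliation M U = kronecker U (1\<^sub>m M)"

lemma ampliation_carrier [simp]:
  "U \<in> carrier_mat n n \<Longrightarrow> ampliation M U \<in> carrier_mat (n * M) (n * M)"
  by (auto simp: ampliation_def)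

lemma index_ampliation:
  assumes "U \<in> carrier_mat n n" "i < n" "j < n" "k < M" "l < M"
  shows "ampliation M U $$ (i * M + k, j * M + l) = (if k = l then U $$ (i, j) else 0)"
  using assms index_kronecker[of i U j k "1\<^sub>m M" l] by (simp add: ampliation_def)

lemma ampliation_isometry:
  assumes U: "U \<in> carrier_mat n n" and iso: "mat_adjoint U * U = 1\<^sub>m n"
  shows "mat_adjoint (ampliation M U) * ampliation M U = 1\<^sub>m (n * M)"
proof (rule eq_matI)
  fix r s assume "r < dim_row (1\<^sub>m (n * M))" "s < dim_col (1\<^sub>m (n * M))"
  then have rs: "r < n * M" "s < n * M" by auto
  define i k j l where d: "i = r div M" "k = r mod M" "j = s div M" "l = s mod M"
  have "M > 0" using rs by (cases M) auto
  then have ij: "i < n" "j < n" and kl: "k < M" "l < M"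
    using rs by (auto simp: d less_mult_imp_div_less)
  have r: "r = i * M + k" and s: "s = j * M + l" by (auto simp: d)
  have "(mat_adjoint (ampliation M U) * ampliation M U) $$ (r, s) =
      (\<Sum>t<n * M. cnj (ampliation M U $$ (t, r)) * ampliation M U $$ (t, s))"
    using rs carrier_matD[OF ampliation_carrier[OF U, of M]]
    by (subst index_mult_sum[of _ "n * M" "n * M"]) auto
  also have "\<dots> = (\<Sum>a<n. \<Sum>b<M. (if b = k then cnj (U $$ (a, i)) else 0) *
      (if b = l then U $$ (a, j) else 0))"
    unfolding sum_lessThan_mult using ij kl U
    by (intro sum.cong refl) (simp add: r s index_ampliation[of U n])
  also have "\<dots> = (\<Sum>a<n. if k = l then cnj (U $$ (a, i)) * U $$ (a, j) else 0)"
    using kl by (intro sum.cong refl) (simp add: if_distrib[of "\<lambda>x. x * _"] if_distrib[of "(*) _"] cong: if_cong)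
  also have "\<dots> = (if k = l then (mat_adjoint U * U) $$ (i, j) else 0)"
    using U ij by (simp add: index_mult_sum[of _ n n _ n] del: index_mult_mat)
  \<comment> \<open>Two indices agree exactly when both their quotients and their remainders by
    \<open>M\<close> agree, so the product of the two identity patterns is the large identity
    matrix.\<close>
  also have "\<dots> = 1\<^sub>m (n * M) $$ (r, s)"
    using ij kl rs \<open>M > 0\<close> unfolding iso by (auto simp: d) (metis div_mult_mod_eq)
  finally show "(mat_adjoint (ampliation M U) * ampliation M U) $$ (r, s) = 1\<^sub>m (n * M) $$ (r, s)" .
qed (use ampliation_carrier[OF U, of M] in auto)

section \<open>Matrix units and conjugation superoperators\<close>

lemma ketbra_carrier [simp]: "ketbra n i j \<in> carrier_mat n n"
  by (simp add: ketbra_def)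

lemma dim_ketbra [simp]: "dim_row (ketbra n i j) = n" "dim_col (ketbra n i j) = n"
  by (simp_all add: ketbra_def)

lemma index_ketbra [simp]:
  "r < n \<Longrightarrow> s < n \<Longrightarrow> ketbra n i j $$ (r, s) = (if r = i \<and> s = j then 1 else 0)"
  by (simp add: ketbra_def)

definition conjugation :: "complex mat \<Rightarrow> complex mat \<Rightarrow> complex mat" where
  "conjugation U A = U * A * mat_adjoint U"

lemma conjugation_carrier [simp]:
  "U \<in> carrier_mat n m \<Longrightarrow> A \<in> carrier_mat m m \<Longrightarrow> conjugation U A \<in> carrier_mat n n"
  unfolding conjugation_def by (metis mult_carrier_mat mat_adjoint_carrier)

lemma index_conjugation:
  assumes U: "U \<in> carrier_mat n m" and A: "A \<in> carrier_mat m m" and "r < n" "s < n"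
  shows "conjugation U A $$ (r, s) = (\<Sum>i<m. \<Sum>j<m. A $$ (i, j) * (U $$ (r, i) * cnj (U $$ (s, j))))"
proof -
  have "conjugation U A $$ (r, s) = (\<Sum>j<m. (\<Sum>i<m. U $$ (r, i) * A $$ (i, j)) * cnj (U $$ (s, j)))"
    using assms unfolding conjugation_def
    by (subst index_mult_sum[of _ n m _ n]) (auto simp: index_mult_sum[of _ n m _ m] simp del: index_mult_mat)
  also have "\<dots> = (\<Sum>j<m. \<Sum>i<m. A $$ (i, j) * (U $$ (r, i) * cnj (U $$ (s, j))))"
    by (simp add: sum_distrib_left sum_distrib_right mult_ac)
  also have "\<dots> = (\<Sum>i<m. \<Sum>j<m. A $$ (i, j) * (U $$ (r, i) * cnj (U $$ (s, j))))"
    by (rule sum.swap)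
  finally show ?thesis .
qed

lemma superoperator_conjugation:
  assumes U: "U \<in> carrier_mat n n"
  shows "superoperator n (conjugation U)"
  unfolding superoperator_def
proof (intro conjI ballI allI)
  fix A B :: "complex mat" assume A: "A \<in> carrier_mat n n" and B: "B \<in> carrier_mat n n"
  show "conjugation U (A + B) = conjugation U A + conjugation U B"
    unfolding conjugation_def mult_add_distrib_mat[OF U A B]
    using U A B by (intro add_mult_distrib_mat[of _ n n]) auto
next
  fix A :: "complex mat" and c assume A: "A \<in> carrier_mat n n"
  show "conjugation U (c \<cdot>\<^sub>m A) = c \<cdot>\<^sub>m conjugation U A"
    unfolding conjugation_def mult_smult_distrib[OF U A]
    using U A by (intro mult_smult_assoc_mat[of _ n n]) auto
qed (use U in simp)

lemma conjugation_ketbra: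
  assumes "U \<in> carrier_mat n n" "i < n" "j < n" "r < n" "s < n"
  shows "conjugation U (ketbra n i j) $$ (r, s) = U $$ (r, i) * cnj (U $$ (s, j))"
proof -
  have "conjugation U (ketbra n i j) $$ (r, s) =
      (\<Sum>i'<n. \<Sum>j'<n. ketbra n i j $$ (i', j') * (U $$ (r, i') * cnj (U $$ (s, j'))))"
    using assms by (intro index_conjugation) auto
  also have "\<dots> = (\<Sum>i'<n. \<Sum>j'<n. if j' = j then if i' = i then U $$ (r, i) * cnj (U $$ (s, j)) else 0 else 0)"
    by (intro sum.cong refl) auto
  also have "\<dots> = U $$ (r, i) * cnj (U $$ (s, j))"
    using assms by simp
  finally show ?thesis .
qed

text \<open>Both sides are linear in the entries of \<open>X\<close>, so it suffices to compare
  coefficients: conjugation maps a matrix unit to a product of an entry of \<open>U\<close> and a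
  conjugated one, and the Kronecker factor \<open>ketbra M k l\<close> supplies the identity pattern
  of the ampliation.\<close>

lemma tensor_superop_conjugation:
  assumes U: "U \<in> carrier_mat n n" and X: "X \<in> carrier_mat (n * M) (n * M)"
  shows "tensor_superop n M (conjugation U) (\<lambda>A. A) X = conjugation (ampliation M U) X"
proof (rule eq_matI)
  have B: "ampliation M U \<in> carrier_mat (n * M) (n * M)" using U by simp
  then have C: "conjugation (ampliation M U) X \<in> carrier_mat (n * M) (n * M)" using X by simp
  fix r s assume "r < dim_row (conjugation (ampliation M U) X)" "s < dim_col (conjugation (ampliation M U) X)"
  then have rs: "r < n * M" "s < n * M" using C by auto
  define a b where d: "a = r div M" "b = s div M"
  define r' s' where d': "r' = r mod M" "s' = s mod M"
  have "M > 0" using rs by (cases M) auto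
  then have ab: "a < n" "b < n" and rs': "r' < M" "s' < M"
    using rs by (auto simp: d d' less_mult_imp_div_less)
  have r: "r = a * M + r'" and s: "s = b * M + s'" by (auto simp: d d')
  have "tensor_superop n M (conjugation U) (\<lambda>A. A) X $$ (r, s) =
      (\<Sum>i<n. \<Sum>j<n. \<Sum>k<M. \<Sum>l<M. X $$ (i * M + k, j * M + l) *
        kronecker (conjugation U (ketbra n i j)) (ketbra M k l) $$ (r, s))"
    using rs by (simp add: tensor_superop_def)
  also have "\<dots> = (\<Sum>i<n. \<Sum>j<n. \<Sum>k<M. \<Sum>l<M. X $$ (i * M + k, j * M + l) *
        (ampliation M U $$ (r, i * M + k) * cnj (ampliation M U $$ (s, j * M + l))))"
  proof (intro sum.cong refl arg_cong[of _ _ "(*) _"])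
    fix i j k l assume "i \<in> {..<n}" "j \<in> {..<n}" "k \<in> {..<M}" "l \<in> {..<M}"
    then show "kronecker (conjugation U (ketbra n i j)) (ketbra M k l) $$ (r, s) =
        ampliation M U $$ (r, i * M + k) * cnj (ampliation M U $$ (s, j * M + l))"
      using ab rs' U carrier_matD[OF conjugation_carrier[OF U ketbra_carrier[of n i j]]]
        index_kronecker[of a "conjugation U (ketbra n i j)" b r' "ketbra M k l" s']
      by (simp add: r s index_ampliation[of U n] conjugation_ketbra)
  qed
  \<comment> \<open>The tensor product sums over the first factor's row and column before the
    second's; the conjugation formula needs each row index \<open>i * M + k\<close> and each column
    index \<open>j * M + l\<close> together.\<close>
  also have "\<dots> = (\<Sum>i<n. \<Sum>k<M. \<Sum>j<n. \<Sum>l<M. X $$ (i * M + k, j * M + l) *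
        (ampliation M U $$ (r, i * M + k) * cnj (ampliation M U $$ (s, j * M + l))))"
    by (intro sum.cong refl sum.swap)
  also have "\<dots> = conjugation (ampliation M U) X $$ (r, s)"
    using rs by (simp add: index_conjugation[OF B X] sum_lessThan_mult)
  finally show "tensor_superop n M (conjugation U) (\<lambda>A. A) X $$ (r, s) =
      conjugation (ampliation M U) X $$ (r, s)" .
qed (use conjugation_carrier[OF ampliation_carrier[OF U] X] in \<open>auto simp: tensor_superop_def\<close>)

lemma superoperator_cong:
  assumes "superoperator n H" "\<And>A. A \<in> carrier_mat n n \<Longrightarrow> G A = H A"
  shows "superoperator n G"
  using assms unfolding superoperator_def by auto

text \<open>Every ampliation of the map is again conjugation by an isometry, and these preserve
  density matrices.\<close>

lemma cpso_conjugation: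
  assumes U: "U \<in> carrier_mat n n" and iso: "mat_adjoint U * U = 1\<^sub>m n"
  shows "cpso n (conjugation U)"
  unfolding cpso_def pso_def
proof (intro conjI allI impI)
  fix M
  show "superoperator (n * M) (tensor_superop n M (conjugation U) (\<lambda>A. A))"
    using superoperator_cong[OF superoperator_conjugation[OF ampliation_carrier[OF U]]]
      tensor_superop_conjugation[OF U] by blast
  fix X assume X: "density (n * M) X"
  then have "X \<in> carrier_mat (n * M) (n * M)" by (simp add: density_def psd_def)
  then show "density (n * M) (tensor_superop n M (conjugation U) (\<lambda>A. A) X)"
    using density_isometry[OF X ampliation_carrier[OF U] ampliation_isometry[OF U iso]]
    by (simp add: tensor_superop_conjugation[OF U] conjugation_def)
qed (use superoperator_conjugation[OF U] in auto)

section \<open>Two-by-two matrices: entries, positivity and square roots\<close>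

declare One_nat_def [simp del]

lemma sum_lessThan_2: "(\<Sum>i<2. f i) = f 0 + f (1 :: nat)"
  by (simp add: numeral_2_eq_2 One_nat_def)

lemma mat_eq_2I:
  assumes "A \<in> carrier_mat 2 2" "B \<in> carrier_mat 2 2"
    and "A $$ (0, 0) = B $$ (0, 0)" "A $$ (0, 1) = B $$ (0, 1)"
    and "A $$ (1, 0) = B $$ (1, 0)" "A $$ (1, 1) = B $$ (1, 1)"
  shows "A = B"
proof (rule eq_matI)
  fix i j assume "i < dim_row B" "j < dim_col B"
  then have "i = 0 \<or> i = 1" "j = 0 \<or> j = 1" using assms(2) by auto
  then show "A $$ (i, j) = B $$ (i, j)" using assms by auto
qed (use assms in auto)

lemma index_mult_2:
  assumes "A \<in> carrier_mat 2 2" "B \<in> carrier_mat 2 2" "i < 2" "j < 2"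
  shows "(A * B) $$ (i, j) = A $$ (i, 0) * B $$ (0, j) + A $$ (i, 1) * B $$ (1, j)"
  using index_mult_sum[OF assms] by (simp add: sum_lessThan_2)

lemma cscalar_prod_unit_vec:
  fixes A :: "complex mat"
  assumes A: "A \<in> carrier_mat n m" and ij: "i < n" "j < m"
  shows "(A *\<^sub>v unit_vec m j) \<bullet>c unit_vec n i = A $$ (i, j)"
proof -
  have "(A *\<^sub>v unit_vec m j) \<bullet>c unit_vec n i =
      (\<Sum>i'<n. \<Sum>j'<m. if j' = j then if i' = i then A $$ (i, j) else 0 else 0)"
    unfolding cscalar_prod_mult_mat_vec_sum[OF A unit_vec_carrier unit_vec_carrier]
    by (intro sum.cong refl) (auto simp: unit_vec_def)
  then show ?thesis using ij by simp
qed

lemma Pr0_index: "\<rho> \<in> carrier_mat 2 2 \<Longrightarrow> Pr0 \<rho> = Re (\<rho> $$ (0, 0))"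
  by (simp add: Pr0_def cscalar_prod_unit_vec)

lemma psd_diag:
  assumes "psd n A" "i < n"
  shows "A $$ (i, i) = of_real (Re (A $$ (i, i)))" "Re (A $$ (i, i)) \<ge> 0"
proof -
  show "A $$ (i, i) = of_real (Re (A $$ (i, i)))"
    using psd_index_cnj[OF assms assms(2)] by (simp add: complex_eq_iff)
  have "Re ((A *\<^sub>v unit_vec n i) \<bullet>c unit_vec n i) \<ge> 0"
    using assms by (simp add: psd_def)
  then show "Re (A $$ (i, i)) \<ge> 0"
    using cscalar_prod_unit_vec[OF psd_carrier[OF assms(1)] assms(2,2)] by simp
qed

text \<open>Cauchy-Schwarz at two basis vectors, where the form returns matrix entries.\<close>

lemma psd_minor:
  assumes P: "psd n A" and ij: "i < n" "j < n"
  shows "(cmod (A $$ (i, j)))\<^sup>2 \<le> Re (A $$ (i, i)) * Re (A $$ (j, j))"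
  using psd_Cauchy_Schwarz[OF P unit_vec_carrier[of n j] unit_vec_carrier[of n i]]
    cscalar_prod_unit_vec[OF psd_carrier[OF P]] ij by (simp add: mult.commute)

text \<open>Real diagonal parameters and a single off-diagonal one make the matrix Hermitian by
  construction.\<close>

definition herm2 :: "real \<Rightarrow> complex \<Rightarrow> real \<Rightarrow> complex mat" where
  "herm2 a b d = mat 2 2 (\<lambda>(i, j). if i = 0 then if j = 0 then of_real a else b
     else if j = 0 then cnj b else of_real d)"

lemma herm2_carrier [simp]: "herm2 a b d \<in> carrier_mat 2 2"
  by (simp add: herm2_def)

lemma index_herm2 [simp]:
  "herm2 a b d $$ (0, 0) = of_real a" "herm2 a b d $$ (0, 1) = b"
  "herm2 a b d $$ (1, 0) = cnj b" "herm2 a b d $$ (1, 1) = of_real d"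
  by (simp_all add: herm2_def)

lemma herm2_eq_iff: "herm2 a b d = herm2 a' b' d' \<longleftrightarrow> a = a' \<and> b = b' \<and> d = d'"
  by (metis index_herm2(1,2,4) of_real_eq_iff)

lemma mat_trace_2: "A \<in> carrier_mat 2 2 \<Longrightarrow> mat_trace A = A $$ (0, 0) + A $$ (1, 1)"
  by (simp add: mat_trace_def sum_lessThan_2)

lemma of_real_cmod_mult_self:
  "complex_of_real (cmod z) * complex_of_real (cmod z) = z * cnj z"
  by (metis complex_norm_square of_real_mult power2_eq_square)

lemma herm2_square:
  "herm2 a b d * herm2 a b d =
     herm2 (a\<^sup>2 + (cmod b)\<^sup>2) (of_real (a + d) * b) (d\<^sup>2 + (cmod b)\<^sup>2)"
  by (rule mat_eq_2I)
    (auto simp: index_mult_2 of_real_cmod_mult_self power2_eq_square algebra_simps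
      simp del: index_mult_mat intro: mult_carrier_mat[of _ 2 2 _ 2])

text \<open>The principal minor criterion. Necessity is the minor inequality; sufficiency bounds the
  mixed term by \<open>sqrt (a * d) |x| |y|\<close> and absorbs it into the diagonal terms by the
  arithmetic-geometric mean inequality.\<close>

lemma psd_2_iff:
  "psd 2 A \<longleftrightarrow> (\<exists>a b d. A = herm2 a b d \<and> a \<ge> 0 \<and> d \<ge> 0 \<and> (cmod b)\<^sup>2 \<le> a * d)"
proof
  assume P: "psd 2 A"
  have "A = herm2 (Re (A $$ (0, 0))) (A $$ (0, 1)) (Re (A $$ (1, 1)))"
    using psd_carrier[OF P] psd_diag(1)[OF P, of 0] psd_diag(1)[OF P, of 1]
      psd_index_cnj[OF P, of 0 1] by (intro mat_eq_2I) auto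
  moreover have "(cmod (A $$ (0, 1)))\<^sup>2 \<le> Re (A $$ (0, 0)) * Re (A $$ (1, 1))"
    using psd_minor[OF P] by simp
  ultimately show "\<exists>a b d. A = herm2 a b d \<and> a \<ge> 0 \<and> d \<ge> 0 \<and> (cmod b)\<^sup>2 \<le> a * d"
    using psd_diag(2)[OF P, of 0] psd_diag(2)[OF P, of 1] by fastforce
next
  assume "\<exists>a b d. A = herm2 a b d \<and> a \<ge> 0 \<and> d \<ge> 0 \<and> (cmod b)\<^sup>2 \<le> a * d"
  then obtain a b d where A: "A = herm2 a b d" and ad: "a \<ge> 0" "d \<ge> 0" and b: "(cmod b)\<^sup>2 \<le> a * d"
    by blast
  have "Re ((A *\<^sub>v v) \<bullet>c v) \<ge> 0" if v: "v \<in> carrier_vec 2" for v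
  proof -
    define x y where "x = v $ 0" and "y = v $ 1"
    have "Re ((A *\<^sub>v v) \<bullet>c v) =
        a * (cmod x)\<^sup>2 + d * (cmod y)\<^sup>2 + 2 * Re (b * y * cnj x)"
      using v unfolding A cscalar_prod_mult_mat_vec_sum[OF herm2_carrier v v]
      by (simp add: sum_lessThan_2 x_def y_def cmod_power2 flip: One_nat_def)
        (simp add: power2_eq_square algebra_simps)
    moreover have "Re (b * y * cnj x) \<ge> - (cmod b * cmod x * cmod y)"
      using abs_Re_le_cmod[of "b * y * cnj x"] by (simp add: norm_mult mult_ac)
    moreover have "cmod b * cmod x * cmod y \<le> sqrt a * sqrt d * cmod x * cmod y"
      using real_le_rsqrt[OF b] by (intro mult_right_mono) (auto simp: real_sqrt_mult)
    moreover have "0 \<le> (sqrt a * cmod x - sqrt d * cmod y)\<^sup>2" by simp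
    then have "2 * (sqrt a * sqrt d * cmod x * cmod y) \<le> a * (cmod x)\<^sup>2 + d * (cmod y)\<^sup>2"
      using ad by (simp add: power2_diff power_mult_distrib mult_ac)
    ultimately show ?thesis by linarith
  qed
  moreover have "mat_adjoint A = A"
    by (rule mat_eq_2I) (auto simp: A herm2_def)
  ultimately show "psd 2 A" by (auto simp: psd_def hermitian_def A)
qed

text \<open>By Cayley-Hamilton a root \<open>S\<close> of \<open>A\<close> satisfies
  \<open>A = S * S = tr(S) S - det(S) 1\<close>, so \<open>S = (A + det(S) 1) / tr(S)\<close>. Here
  \<open>\<delta>\<close> is \<open>det(S)\<close>, the root of \<open>det(A)\<close>, and
  \<open>t\<close> is \<open>tr(S)\<close>, since \<open>tr(S)^2 = tr(A) + 2 det(S)\<close>.\<close>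

lemma psd_sqrt_herm2:
  assumes ad: "a \<ge> 0" "d \<ge> 0" and b: "(cmod b)\<^sup>2 \<le> a * d"
  defines "\<delta> \<equiv> sqrt (a * d - (cmod b)\<^sup>2)"
  defines "t \<equiv> sqrt (a + d + 2 * \<delta>)"
  shows "psd_sqrt 2 (herm2 a b d) = herm2 ((a + \<delta>) / t) (b / of_real t) ((d + \<delta>) / t)"
  unfolding psd_sqrt_def
proof (rule the_equality)
  have \<delta>: "\<delta> \<ge> 0" "\<delta>\<^sup>2 = a * d - (cmod b)\<^sup>2" using b by (simp_all add: \<delta>_def)
  have t: "t \<ge> 0" "t\<^sup>2 = a + d + 2 * \<delta>" using ad \<delta> by (simp_all add: t_def)
  let ?S = "herm2 ((a + \<delta>) / t) (b / of_real t) ((d + \<delta>) / t)"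
  have "(cmod b)\<^sup>2 \<le> (a + \<delta>) * (d + \<delta>)"
  proof -
    have "(a + \<delta>) * (d + \<delta>) = a * d + (a + d) * \<delta> + \<delta>\<^sup>2"
      by (simp add: power2_eq_square algebra_simps)
    then show ?thesis using ad \<delta>(1) b by (smt (verit) mult_nonneg_nonneg zero_le_power2)
  qed
  then have "(cmod (b / of_real t))\<^sup>2 \<le> (a + \<delta>) / t * ((d + \<delta>) / t)"
    by (simp add: norm_divide power_divide divide_right_mono power2_eq_square)
  then have "psd 2 ?S"
    unfolding psd_2_iff using ad \<delta>(1) t(1) by (metis add_nonneg_nonneg divide_nonneg_nonneg)
  moreover have "?S * ?S = herm2 a b d"
  proof (cases "t = 0")
    case True
    \<comment> \<open>If \<open>t = 0\<close>, all entries of the matrix vanish; division by zero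
      yields zero, so the formula still returns the right root.\<close>
    then have "a = 0 \<and> d = 0 \<and> b = 0" using t(2) ad \<delta>(1) b by (auto simp: add_nonneg_eq_0_iff)
    with True show ?thesis by (simp add: herm2_square)
  next
    case False
    have "(a + \<delta>)\<^sup>2 + (cmod b)\<^sup>2 = a * t\<^sup>2" "(d + \<delta>)\<^sup>2 + (cmod b)\<^sup>2 = d * t\<^sup>2"
      unfolding t(2) power2_sum \<delta>(2) by (simp_all add: power2_eq_square algebra_simps)
    moreover have "(a + \<delta>) / t + (d + \<delta>) / t = t\<^sup>2 / t"
      unfolding t(2) by (simp flip: add_divide_distrib)
    then have "((a + \<delta>) / t + (d + \<delta>) / t) / t = 1"
      using False by (simp add: power2_eq_square)
    then have "of_real ((a + \<delta>) / t + (d + \<delta>) / t) * (b / of_real t) = b"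
      by (metis (no_types, opaque_lifting) mult_1 of_real_1 of_real_divide times_divide_eq_left times_divide_eq_right)
    ultimately show ?thesis
      unfolding herm2_square herm2_eq_iff using False
      by (simp add: norm_divide power_divide flip: add_divide_distrib)
  qed
  ultimately show "psd 2 ?S \<and> ?S * ?S = herm2 a b d" ..
  fix S assume S: "psd 2 S \<and> S * S = herm2 a b d"
  then obtain p q r where Sdef: "S = herm2 p q r" and pr: "p \<ge> 0" "r \<ge> 0" and q: "(cmod q)\<^sup>2 \<le> p * r"
    unfolding psd_2_iff by blast
  have a: "a = p\<^sup>2 + (cmod q)\<^sup>2" and d: "d = r\<^sup>2 + (cmod q)\<^sup>2" and b: "b = of_real (p + r) * q"
    using S unfolding Sdef herm2_square herm2_eq_iff by auto
  \<comment> \<open>Uniqueness: multiplicativity of the determinant identifies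
    \<open>\<delta>\<close> with the determinant of an arbitrary positive root, and then
    \<open>t\<close> with its trace, after which its entries are forced.\<close>
  have "a * d - (cmod b)\<^sup>2 = (p * r - (cmod q)\<^sup>2)\<^sup>2"
    unfolding a b d norm_mult norm_of_real power_mult_distrib power2_abs
    by (simp add: power2_eq_square algebra_simps)
  then have \<delta>': "\<delta> = p * r - (cmod q)\<^sup>2" using q by (simp add: \<delta>_def)
  have "a + d + 2 * \<delta> = (p + r)\<^sup>2"
    unfolding \<delta>' a d by (simp add: power2_eq_square algebra_simps)
  then have t': "t = p + r" using pr by (simp add: t_def)
  show "S = ?S"
  proof (cases "t = 0")
    case True
    then have "p = 0 \<and> r = 0" using t' pr by linarith
    with True q show ?thesis by (simp add: Sdef)
  next
    case False
    moreover have "a + \<delta> = p * t" "d + \<delta> = r * t"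
      unfolding a d \<delta>' t' by (simp_all add: power2_eq_square algebra_simps)
    ultimately show ?thesis
      unfolding Sdef herm2_eq_iff using b t' by (simp flip: of_real_add)
  qed
qed

section \<open>The trace norm of 2-by-2 matrices and the superoperator norm\<close>

definition frob2 :: "complex mat \<Rightarrow> real" where
  "frob2 V = (cmod (V $$ (0, 0)))\<^sup>2 + (cmod (V $$ (0, 1)))\<^sup>2 + (cmod (V $$ (1, 0)))\<^sup>2 + (cmod (V $$ (1, 1)))\<^sup>2"

text \<open>With singular values \<open>s1\<close> and \<open>s2\<close>,
  \<open>(s1 + s2)^2 = (s1^2 + s2^2) + 2 s1 s2\<close>: the first summand is the squared Frobenius
  norm \<open>frob2 V\<close>, and \<open>s1 s2\<close> is the modulus of the determinant.\<close>

lemma trace_norm_2: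
  assumes V: "V \<in> carrier_mat 2 2"
  shows "trace_norm 2 V =
    sqrt (frob2 V + 2 * cmod (V $$ (0, 0) * V $$ (1, 1) - V $$ (0, 1) * V $$ (1, 0)))"
proof -
  define x y z w where xyzw: "x = V $$ (0, 0)" "y = V $$ (0, 1)" "z = V $$ (1, 0)" "w = V $$ (1, 1)"
  define a b d where a: "a = (cmod x)\<^sup>2 + (cmod z)\<^sup>2" and b: "b = cnj x * y + cnj z * w"
    and d: "d = (cmod y)\<^sup>2 + (cmod w)\<^sup>2"
  define \<delta> where "\<delta> = cmod (x * w - y * z)"
  define t where "t = sqrt (a + d + 2 * \<delta>)"
  have VV: "mat_adjoint V * V = herm2 a b d"
    using V by (intro mat_eq_2I)
      (auto simp: index_mult_2 xyzw a b d of_real_cmod_mult_self power2_eq_square algebra_simps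
        simp del: index_mult_mat intro: mult_carrier_mat[of _ 2 2 _ 2])
  have det: "a * d - (cmod b)\<^sup>2 = \<delta>\<^sup>2"
    unfolding a b d \<delta>_def cmod_power2 by (simp add: power2_eq_square algebra_simps)
  have "a \<ge> 0" "d \<ge> 0" by (simp_all add: a d)
  moreover have "(cmod b)\<^sup>2 \<le> a * d" using det zero_le_power2[of \<delta>] by linarith
  moreover have "sqrt (a * d - (cmod b)\<^sup>2) = \<delta>" unfolding det by (simp add: \<delta>_def)
  ultimately have "psd_sqrt 2 (mat_adjoint V * V) = herm2 ((a + \<delta>) / t) (b / of_real t) ((d + \<delta>) / t)"
    using psd_sqrt_herm2[of a d b] unfolding VV t_def by simp
  then have "trace_norm 2 V = (a + \<delta>) / t + (d + \<delta>) / t"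
    by (simp add: trace_norm_def mat_trace_2)
  also have "\<dots> = (a + d + 2 * \<delta>) / t" by (simp add: add_divide_distrib)
  also have "\<dots> = t"
    using \<open>a \<ge> 0\<close> \<open>d \<ge> 0\<close> by (simp add: t_def \<delta>_def real_div_sqrt)
  finally show ?thesis
    by (simp add: t_def a d \<delta>_def frob2_def xyzw add_ac)
qed

lemma frob2_nonneg [simp]: "frob2 V \<ge> 0"
  by (simp add: frob2_def)

lemma frob2_le_trace_norm:
  assumes "V \<in> carrier_mat 2 2"
  shows "frob2 V \<le> (trace_norm 2 V)\<^sup>2"
  by (simp add: trace_norm_2[OF assms])

lemma trace_norm_nonneg: "V \<in> carrier_mat 2 2 \<Longrightarrow> trace_norm 2 V \<ge> 0"
  by (simp add: trace_norm_2)

text \<open>Twice the modulus of the determinant is at most the squared Frobenius norm, by the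
  arithmetic-geometric mean inequality on each of its two products.\<close>

lemma trace_norm_le_frob2:
  assumes "V \<in> carrier_mat 2 2"
  shows "trace_norm 2 V \<le> sqrt (2 * frob2 V)"
proof -
  have "2 * cmod (x * w - y * z) \<le> (cmod x)\<^sup>2 + (cmod y)\<^sup>2 + (cmod z)\<^sup>2 + (cmod w)\<^sup>2" for x y z w
  proof -
    have "cmod (x * w - y * z) \<le> cmod x * cmod w + cmod y * cmod z"
      using norm_triangle_ineq4[of "x * w" "y * z"] by (simp add: norm_mult)
    then show ?thesis
      using sum_squares_bound[of "cmod x" "cmod w"] sum_squares_bound[of "cmod y" "cmod z"] by simp
  qed
  from this[of "V $$ (0, 0)" "V $$ (1, 1)" "V $$ (0, 1)" "V $$ (1, 0)"] show ?thesis
    unfolding trace_norm_2[OF assms] by (simp add: frob2_def)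
qed

lemma superoperator_carrier:
  "superoperator n G \<Longrightarrow> A \<in> carrier_mat n n \<Longrightarrow> G A \<in> carrier_mat n n"
  by (simp add: superoperator_def)

lemma index_superoperator_2:
  assumes G: "superoperator 2 G" and A: "A \<in> carrier_mat 2 2" and rs: "r < 2" "s < 2"
  shows "G A $$ (r, s) = (\<Sum>i<2. \<Sum>j<2. A $$ (i, j) * G (ketbra 2 i j) $$ (r, s))"
proof -
  let ?t = "\<lambda>i j. A $$ (i, j) \<cdot>\<^sub>m ketbra 2 i j"
  have "A = (?t 0 0 + ?t 0 1) + (?t 1 0 + ?t 1 1)"
    using A by (intro mat_eq_2I) auto
  then have "G A = G ((?t 0 0 + ?t 0 1) + (?t 1 0 + ?t 1 1))"
    by (rule arg_cong)
  also have "\<dots> = (A $$ (0, 0) \<cdot>\<^sub>m G (ketbra 2 0 0) + A $$ (0, 1) \<cdot>\<^sub>m G (ketbra 2 0 1)) +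
      (A $$ (1, 0) \<cdot>\<^sub>m G (ketbra 2 1 0) + A $$ (1, 1) \<cdot>\<^sub>m G (ketbra 2 1 1))"
    using G by (simp add: superoperator_def)
  finally show ?thesis
    using rs carrier_matD[OF superoperator_carrier[OF G ketbra_carrier]]
    by (simp add: sum_lessThan_2)
qed

lemma superoperator_diff:
  assumes "superoperator n G" "superoperator n H"
  shows "superoperator n (\<lambda>V. G V - H V)"
  unfolding superoperator_def
proof (intro conjI ballI allI)
  fix A B :: "complex mat" assume "A \<in> carrier_mat n n" "B \<in> carrier_mat n n"
  then have "G (A + B) = G A + G B" "H (A + B) = H A + H B"
    and "G A \<in> carrier_mat n n" "G B \<in> carrier_mat n n" "H A \<in> carrier_mat n n" "H B \<in> carrier_mat n n"
    using assms by (auto simp: superoperator_def)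
  then show "G (A + B) - H (A + B) = G A - H A + (G B - H B)"
    by (intro eq_matI) auto
next
  fix A :: "complex mat" and c assume "A \<in> carrier_mat n n"
  then have "G (c \<cdot>\<^sub>m A) = c \<cdot>\<^sub>m G A" "H (c \<cdot>\<^sub>m A) = c \<cdot>\<^sub>m H A"
    and "G A \<in> carrier_mat n n" "H A \<in> carrier_mat n n"
    using assms by (auto simp: superoperator_def)
  then show "G (c \<cdot>\<^sub>m A) - H (c \<cdot>\<^sub>m A) = c \<cdot>\<^sub>m (G A - H A)"
    by (intro eq_matI) (auto simp: algebra_simps)
qed (use assms in \<open>auto simp: superoperator_def intro: minus_carrier_mat\<close>)

text \<open>Source of the factor 6: trace norm 1 bounds the Frobenius norm of \<open>V\<close> by 1,
  hence the sum of the moduli of its four entries by 2. So each entry of \<open>D V\<close> is at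
  most \<open>2 * K\<close>, \<open>frob2 (D V)\<close> is at most \<open>16 * K^2\<close>, and the
  trace norm is at most \<open>sqrt 32 * K\<close>.\<close>

lemma trace_norm_superoperator_le:
  assumes D: "superoperator 2 D" and V: "V \<in> carrier_mat 2 2" and tn: "trace_norm 2 V = 1"
    and K: "\<And>i j r s. i < 2 \<Longrightarrow> j < 2 \<Longrightarrow> r < 2 \<Longrightarrow> s < 2 \<Longrightarrow> cmod (D (ketbra 2 i j) $$ (r, s)) \<le> K"
  shows "trace_norm 2 (D V) \<le> 6 * K"
proof -
  have K0: "K \<ge> 0" by (rule order_trans[OF norm_ge_zero K[of 0 0 0 0]]) auto
  define S where "S = (\<Sum>i<2. \<Sum>j<2. cmod (V $$ (i, j)))"
  have S: "S\<^sup>2 \<le> 4 * frob2 V"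
  proof -
    have "(a + b + c + d)\<^sup>2 \<le> 4 * (a\<^sup>2 + b\<^sup>2 + c\<^sup>2 + d\<^sup>2)" for a b c d :: real
    proof -
      have "(a + b + c + d)\<^sup>2 + ((a - b)\<^sup>2 + (a - c)\<^sup>2 + (a - d)\<^sup>2 + (b - c)\<^sup>2 + (b - d)\<^sup>2 + (c - d)\<^sup>2) =
          4 * (a\<^sup>2 + b\<^sup>2 + c\<^sup>2 + d\<^sup>2)"
        by (simp add: power2_eq_square algebra_simps)
      moreover have "0 \<le> (a - b)\<^sup>2 + (a - c)\<^sup>2 + (a - d)\<^sup>2 + (b - c)\<^sup>2 + (b - d)\<^sup>2 + (c - d)\<^sup>2"
        by simp
      ultimately show ?thesis by linarith
    qed
    then show ?thesis by (simp add: S_def sum_lessThan_2 frob2_def add_ac)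
  qed
  have "frob2 V \<le> 1" using frob2_le_trace_norm[OF V] tn by simp
  with S have "S\<^sup>2 \<le> 2\<^sup>2" by simp
  then have S2: "S \<le> 2" by (rule power2_le_imp_le) simp
  have entry: "cmod (D V $$ (r, s)) \<le> 2 * K" if "r < 2" "s < 2" for r s
  proof -
    have "cmod (D V $$ (r, s)) \<le> (\<Sum>i<2. \<Sum>j<2. cmod (V $$ (i, j)) * K)"
      unfolding index_superoperator_2[OF D V that]
      by (intro sum_norm_le) (auto simp: norm_mult that intro!: mult_left_mono K)
    also have "\<dots> = S * K" by (simp add: S_def sum_distrib_right)
    also have "\<dots> \<le> 2 * K" using S2 K0 by (rule mult_right_mono)
    finally show ?thesis .
  qed
  have "(cmod (D V $$ (r, s)))\<^sup>2 \<le> (2 * K)\<^sup>2" if "r < 2" "s < 2" for r s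
    using entry[OF that] by (intro power_mono) auto
  from this[of 0 0] this[of 0 1] this[of 1 0] this[of 1 1]
  have "frob2 (D V) \<le> 4 * (2 * K)\<^sup>2" by (simp add: frob2_def)
  then have "2 * frob2 (D V) \<le> 32 * K\<^sup>2" by (simp add: power_mult_distrib)
  also have "\<dots> \<le> (6 * K)\<^sup>2" by (simp add: power_mult_distrib)
  finally have "2 * frob2 (D V) \<le> (6 * K)\<^sup>2" .
  then have "sqrt (2 * frob2 (D V)) \<le> 6 * K" using K0 by (intro real_le_lsqrt) auto
  with trace_norm_le_frob2[OF superoperator_carrier[OF D V]] show ?thesis by linarith
qed

lemma trace_norm_ketbra: "trace_norm 2 (ketbra 2 0 0) = 1"
  by (simp add: trace_norm_2 frob2_def)

lemma superop_norm_le: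
  assumes "superoperator 2 D"
    and "\<And>i j r s. i < 2 \<Longrightarrow> j < 2 \<Longrightarrow> r < 2 \<Longrightarrow> s < 2 \<Longrightarrow> cmod (D (ketbra 2 i j) $$ (r, s)) \<le> K"
  shows "superop_norm 2 D \<le> 6 * K"
  unfolding superop_norm_def
proof (rule cSup_least)
  show "{trace_norm 2 (D V) |V. V \<in> carrier_mat 2 2 \<and> trace_norm 2 V = 1} \<noteq> {}"
    using trace_norm_ketbra ketbra_carrier by blast
qed (use trace_norm_superoperator_le[OF assms(1) _ _ assms(2)] in auto)

text \<open>A real supremum dominates the elements only of a set that is bounded above. The sum
  \<open>K\<close> of all entry moduli provides such a bound, and \<open>ketbra 2 0 0\<close> a
  nonnegative element.\<close>

lemma superop_norm_nonneg:
  assumes D: "superoperator 2 D"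
  shows "superop_norm 2 D \<ge> 0"
proof -
  define K where "K = (\<Sum>(i, j, r, s)\<in>{..<2} \<times> {..<2} \<times> {..<2} \<times> {..<2}. cmod (D (ketbra 2 i j) $$ (r, s)))"
  have "cmod (D (ketbra 2 i j) $$ (r, s)) \<le> K" if "i < 2" "j < 2" "r < 2" "s < 2" for i j r s
    unfolding K_def
    using member_le_sum[of "(i, j, r, s)" "{..<2} \<times> {..<2} \<times> {..<2} \<times> {..<2}"
        "\<lambda>(i, j, r, s). cmod (D (ketbra 2 i j) $$ (r, s))"] that by auto
  then have "bdd_above {trace_norm 2 (D V) |V. V \<in> carrier_mat 2 2 \<and> trace_norm 2 V = 1}"
    using trace_norm_superoperator_le[OF D, of _ K] by (intro bdd_aboveI[of _ "6 * K"]) auto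
  then have "trace_norm 2 (D (ketbra 2 0 0)) \<le> superop_norm 2 D"
    unfolding superop_norm_def using trace_norm_ketbra ketbra_carrier by (intro cSup_upper) auto
  then show ?thesis
    using trace_norm_nonneg[OF superoperator_carrier[OF D ketbra_carrier, of 0 0]] by linarith
qed

text \<open>The infimum lies below the value at \<open>H\<close> because zero bounds all the
  distances from below.\<close>

lemma superop_set_dist_le:
  assumes "superoperator 2 G" "H \<in> F" "\<And>H. H \<in> F \<Longrightarrow> superoperator 2 H"
  shows "superop_set_dist 2 G F \<le> superop_dist 2 G H"
  unfolding superop_set_dist_def
  using assms superop_norm_nonneg[OF superoperator_diff]
  by (intro cINF_lower bdd_belowI[of _ 0]) (auto simp: superop_dist_def)

section \<open>Complete positivity and the Choi matrix\<close>

text \<open>The instance \<open>M = 1\<close>: on 2-by-2 matrices, tensoring with the identity of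
  dimension one changes nothing.\<close>

lemma pso_of_cpso_2:
  assumes G: "cpso 2 G"
  shows "pso 2 G"
proof -
  have lin: "superoperator 2 G" using G by (simp add: cpso_def)
  have "tensor_superop 2 1 G (\<lambda>A. A) X = G X" if X: "X \<in> carrier_mat 2 2" for X
  proof (rule eq_matI)
    have GX: "dim_row (G X) = 2" "dim_col (G X) = 2"
      using superoperator_carrier[OF lin X] by auto
    then show "dim_row (tensor_superop 2 1 G (\<lambda>A. A) X) = dim_row (G X)"
      "dim_col (tensor_superop 2 1 G (\<lambda>A. A) X) = dim_col (G X)"
      by (simp_all add: tensor_superop_def)
    fix r s assume "r < dim_row (G X)" "s < dim_col (G X)"
    with GX have rs: "r < 2" "s < 2" by auto
    have "kronecker (G (ketbra 2 i j)) (ketbra 1 0 0) $$ (r, s) = G (ketbra 2 i j) $$ (r, s)" for i j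
      using rs carrier_matD[OF superoperator_carrier[OF lin ketbra_carrier[of 2 i j]]]
        index_kronecker[of r "G (ketbra 2 i j)" s 0 "ketbra 1 0 0" 0] by simp
    then show "tensor_superop 2 1 G (\<lambda>A. A) X $$ (r, s) = G X $$ (r, s)"
      using rs by (simp add: index_superoperator_2[OF lin X rs] tensor_superop_def)
  qed
  moreover have "\<forall>M>0. pso (2 * M) (tensor_superop 2 M G (\<lambda>A. A))"
    using G unfolding cpso_def by (rule conjunct2)
  from this[rule_format, of 1] have "pso 2 (tensor_superop 2 1 G (\<lambda>A. A))" by simp
  moreover have "density 2 \<rho> \<Longrightarrow> \<rho> \<in> carrier_mat 2 2" for \<rho>
    by (simp add: density_def psd_def)
  ultimately show ?thesis
    using lin unfolding pso_def by metis
qed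

text \<open>An index \<open>r\<close> encodes the output index \<open>r div n\<close> and the input
  index \<open>r mod n\<close>, the order in which \<open>tensor_superop\<close> places the factor
  acted on by \<open>G\<close> first.\<close>

definition choi :: "nat \<Rightarrow> (complex mat \<Rightarrow> complex mat) \<Rightarrow> complex mat" where
  "choi n G = mat (n * n) (n * n) (\<lambda>(r, s). G (ketbra n (r mod n) (s mod n)) $$ (r div n, s div n))"

lemma psd_smult:
  assumes "psd n A" "c \<ge> 0"
  shows "psd n (complex_of_real c \<cdot>\<^sub>m A)"
proof -
  have A: "A \<in> carrier_mat n n" using psd_carrier[OF assms(1)] .
  have "mat_adjoint (complex_of_real c \<cdot>\<^sub>m A) = complex_of_real c \<cdot>\<^sub>m A"
    using A by (intro eq_matI) (auto simp: psd_index_cnj[OF assms(1), symmetric])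
  moreover have "((complex_of_real c \<cdot>\<^sub>m A) *\<^sub>v v) \<bullet>c v = of_real c * ((A *\<^sub>v v) \<bullet>c v)"
    if v: "v \<in> carrier_vec n" for v
  proof -
    have "complex_of_real c \<cdot>\<^sub>m A \<in> carrier_mat n n" using A by simp
    from cscalar_prod_mult_mat_vec_sum[OF this v v] cscalar_prod_mult_mat_vec_sum[OF A v v]
    show ?thesis using A by (simp add: sum_distrib_left mult_ac)
  qed
  ultimately show ?thesis using assms A by (simp add: psd_def hermitian_def)
qed

text \<open>The Choi matrix is \<open>n\<close> times the image of the maximally entangled state.\<close>

lemma psd_choi:
  assumes G: "cpso n G" and n: "n > 0"
  shows "psd (n * n) (choi n G)"
proof -
  \<comment> \<open>\<open>B\<close> is the maximally entangled unit vector as a column, an isometry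
    from dimension one, so \<open>X\<close> is a pure density matrix.\<close>
  define B :: "complex mat" where
    "B = mat (n * n) 1 (\<lambda>(r, s). if r div n = r mod n then 1 / of_real (sqrt n) else 0)"
  define X where "X = B * 1\<^sub>m 1 * mat_adjoint B"
  define T where "T = tensor_superop n n G (\<lambda>A. A) X"
  have lin: "superoperator n G" using G by (simp add: cpso_def)
  have Bc: "B \<in> carrier_mat (n * n) 1" by (simp add: B_def)
  have sq: "complex_of_real (sqrt n) * complex_of_real (sqrt n) = of_nat n"
    by (metis of_nat_0_le_iff of_real_mult of_real_of_nat_eq real_sqrt_mult_self abs_of_nonneg)
  have B: "B $$ (i * n + k, 0) = (if i = k then 1 / of_real (sqrt n) else 0)" if "i < n" "k < n" for i k
    using that mult_add_less[OF that] by (simp add: B_def)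
  have "density (n * n) X"
    unfolding X_def
  proof (rule density_isometry[OF _ Bc])
    have "(mat_adjoint B * B) $$ (0, 0) = (\<Sum>t<n * n. cnj (B $$ (t, 0)) * B $$ (t, 0))"
      using Bc by (subst index_mult_sum[of _ 1 "n * n" _ 1]) auto
    also have "\<dots> = (\<Sum>i<n. \<Sum>k<n. if k = i then 1 / of_nat n else 0)"
      unfolding sum_lessThan_mult by (intro sum.cong refl) (auto simp: B sq)
    also have "\<dots> = 1" using n by simp
    finally show "mat_adjoint B * B = 1\<^sub>m 1"
      using Bc by (intro eq_matI) auto
    have "psd 1 (1\<^sub>m 1 :: complex mat)"
      unfolding psd_def hermitian_def
    proof (intro conjI ballI)
      fix v :: "complex vec" assume v: "v \<in> carrier_vec 1"
      then show "Re ((1\<^sub>m 1 *\<^sub>v v) \<bullet>c v) \<ge> 0"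
        unfolding cscalar_prod_mult_mat_vec_sum[OF one_carrier_mat v v]
        by (auto intro!: add_nonneg_nonneg sum_nonneg)
    qed (auto intro!: eq_matI)
    then show "density 1 (1\<^sub>m 1)" by (simp add: density_def mat_trace_def)
  qed
  moreover have "pso (n * n) (tensor_superop n n G (\<lambda>A. A))"
    using G n by (simp add: cpso_def)
  ultimately have "psd (n * n) T" by (simp add: T_def pso_def density_def)
  then have "psd (n * n) (complex_of_real n \<cdot>\<^sub>m T)" by (intro psd_smult) auto
  moreover have "complex_of_real n \<cdot>\<^sub>m T = choi n G"
  proof (rule eq_matI)
    fix r s assume "r < dim_row (choi n G)" "s < dim_col (choi n G)"
    then have rs: "r < n * n" "s < n * n" by (auto simp: choi_def)
    define a b k' l' where d: "a = r div n" "b = s div n" "k' = r mod n" "l' = s mod n"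
    have lt: "a < n" "b < n" "k' < n" "l' < n"
      using rs n by (auto simp: d less_mult_imp_div_less)
    have r: "r = a * n + k'" and s: "s = b * n + l'" by (auto simp: d)
    have X: "X $$ (i * n + k, j * n + l) = (if i = k \<and> j = l then 1 / of_nat n else 0)"
      if "i < n" "j < n" "k < n" "l < n" for i j k l
    proof -
      have "X $$ (i * n + k, j * n + l) = B $$ (i * n + k, 0) * cnj (B $$ (j * n + l, 0))"
        using that Bc mult_add_less[of i n k n] mult_add_less[of j n l n]
          index_conjugation[OF Bc one_carrier_mat, of "i * n + k" "j * n + l"]
        by (simp add: X_def conjugation_def One_nat_def)
      then show ?thesis using that by (simp add: B sq)
    qed
    have "T $$ (r, s) = (\<Sum>i<n. \<Sum>j<n. \<Sum>k<n. \<Sum>l<n. X $$ (i * n + k, j * n + l) *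
        kronecker (G (ketbra n i j)) (ketbra n k l) $$ (r, s))"
      using rs by (simp add: T_def tensor_superop_def)
    \<comment> \<open>\<open>X\<close> vanishes unless \<open>i = k\<close> and
      \<open>j = l\<close>, and the Kronecker factor unless \<open>k = k'\<close> and
      \<open>l = l'\<close>; a single term survives.\<close>
    also have "\<dots> = (\<Sum>i<n. \<Sum>j<n. \<Sum>k<n. \<Sum>l<n. if l = l' then if k = k' then if j = l' then if i = k'
        then G (ketbra n k' l') $$ (a, b) / of_nat n else 0 else 0 else 0 else 0)"
    proof (intro sum.cong refl)
      fix i j k l assume "i \<in> {..<n}" "j \<in> {..<n}" "k \<in> {..<n}" "l \<in> {..<n}"
      then show "X $$ (i * n + k, j * n + l) * kronecker (G (ketbra n i j)) (ketbra n k l) $$ (r, s) =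
          (if l = l' then if k = k' then if j = l' then if i = k'
           then G (ketbra n k' l') $$ (a, b) / of_nat n else 0 else 0 else 0 else 0)"
        using lt carrier_matD[OF superoperator_carrier[OF lin ketbra_carrier[of n i j]]]
          index_kronecker[of a "G (ketbra n i j)" b k' "ketbra n k l" l']
        by (auto simp: X r s)
    qed
    also have "\<dots> = G (ketbra n k' l') $$ (a, b) / of_nat n"
      using lt by simp
    finally show "(complex_of_real n \<cdot>\<^sub>m T) $$ (r, s) = choi n G $$ (r, s)"
      using rs n by (simp add: T_def tensor_superop_def choi_def d)
  qed (auto simp: T_def tensor_superop_def choi_def)
  ultimately show ?thesis by simp
qed

section \<open>Perturbation estimates for the parameters\<close>

text \<open>The bounds on \<open>y\<close> and \<open>z\<close> are assumed for every admissible
  phase, as \<open>w\<close> is chosen only in the proof. The constants arise as 4 (half of the gap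
  \<open>8 * \<epsilon>\<close>), 5 = 1 + 4, 6 = 1 + 5 and 8 = 3 + 5.\<close>

lemma Hadamard_parameters:
  fixes p q \<epsilon> :: real and c d x y z :: complex
  assumes \<epsilon>: "0 \<le> \<epsilon>" "\<epsilon> \<le> 1" and p: "\<bar>p - 1 / 2\<bar> \<le> \<epsilon>"
    and p01: "0 \<le> p" "p \<le> 1" and q01: "0 \<le> q" "q \<le> 1"
    and c: "(cmod c)\<^sup>2 \<le> p * (1 - p)" and d: "(cmod d)\<^sup>2 \<le> q * (1 - q)"
    and x: "(cmod x)\<^sup>2 \<le> p * q" "(cmod x)\<^sup>2 \<le> (1 - p) * (1 - q)"
    and e0: "p\<^sup>2 + (1 - p) * q + 2 * Re (c * x) \<ge> 1 - \<epsilon>"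
    and e1: "q * p + (1 - q) * q + 2 * Re (d * x) \<le> \<epsilon>"
    and y: "\<And>w. cmod w = 1 \<Longrightarrow> c = of_real (cmod c) * cnj w \<Longrightarrow>
      (cmod (x + w * y))\<^sup>2 \<le> (1 - 2 * cmod c) * (1 - q)"
    and z: "\<And>w. cmod w = 1 \<Longrightarrow> c = of_real (cmod c) * cnj w \<Longrightarrow>
      (cmod (z - w * x))\<^sup>2 \<le> (1 - 2 * cmod c) * q"
  obtains w where "cmod w = 1" "\<bar>q - 1 / 2\<bar> \<le> 2 * sqrt \<epsilon>"
    "cmod (c - cnj w / 2) \<le> 4 * sqrt \<epsilon>" "cmod (d + cnj w / 2) \<le> 6 * sqrt \<epsilon>"
    "cmod (x - w / 2) \<le> 5 * sqrt \<epsilon>" "cmod (y + 1 / 2) \<le> 8 * sqrt \<epsilon>"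
    "cmod (z - w * w / 2) \<le> 8 * sqrt \<epsilon>"
proof -
  \<comment> \<open>The conjugate phase of \<open>c\<close>; for \<open>c = 0\<close> every unit
    number is admissible and 1 is taken.\<close>
  define w where "w = (if c = 0 then 1 else cnj c / of_real (cmod c))"
  have w: "cmod w = 1" "c = of_real (cmod c) * cnj w"
    by (auto simp: w_def norm_divide)
  define s where "s = sqrt \<epsilon>"
  have s: "0 \<le> s" "s\<^sup>2 = \<epsilon>" using \<epsilon> by (auto simp: s_def)
  have "s \<le> 1" using \<epsilon> by (simp add: s_def)
  then have \<epsilon>s: "\<epsilon> \<le> s" using s mult_left_mono[of s 1 s] by (simp add: power2_eq_square)
  \<comment> \<open>Expanding the last square gives \<open>|x|^2 + |c|^2 - 2 Re (c * x)\<close>, so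
    the moduli cancel. The identity for \<open>d\<close> below works in the same way.\<close>
  have "((1 - p) * (1 - q) - (cmod x)\<^sup>2) + (p * (1 - p) - (cmod c)\<^sup>2) + (cmod (x - cnj c))\<^sup>2 =
      (1 - p) * (1 - q) + p * (1 - p) - 2 * Re (c * x)"
    unfolding cmod_power2 by (simp add: power2_eq_square algebra_simps)
  also have "\<dots> \<le> \<epsilon>" using e0 by (simp add: power2_eq_square algebra_simps)
  finally have k0: "((1 - p) * (1 - q) - (cmod x)\<^sup>2) + (p * (1 - p) - (cmod c)\<^sup>2) + (cmod (x - cnj c))\<^sup>2 \<le> \<epsilon>" .
  have "(p * q - (cmod x)\<^sup>2) + (q * (1 - q) - (cmod d)\<^sup>2) + (cmod (x + cnj d))\<^sup>2 =
      q * p + (1 - q) * q + 2 * Re (d * x)"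
    unfolding cmod_power2 by (simp add: power2_eq_square algebra_simps)
  from this[symmetric] e1 have k1: "(p * q - (cmod x)\<^sup>2) + (q * (1 - q) - (cmod d)\<^sup>2) + (cmod (x + cnj d))\<^sup>2 \<le> \<epsilon>"
    by (rule subst[where P = "\<lambda>t. t \<le> \<epsilon>"])
  have "(cmod (x - cnj c))\<^sup>2 \<le> s\<^sup>2" unfolding s(2) using k0 c x(2) by linarith
  then have xc: "cmod (x - cnj c) \<le> s" using s(1) by (rule power2_le_imp_le)
  have "(cmod (x + cnj d))\<^sup>2 \<le> s\<^sup>2" unfolding s(2) using k1 d x(1) by linarith
  then have xd: "cmod (x + cnj d) \<le> s" using s(1) by (rule power2_le_imp_le)
  \<comment> \<open>Each of \<open>p * q\<close> and \<open>(1 - p) * (1 - q)\<close> lies between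
    \<open>|x|^2\<close> and \<open>|x|^2 + \<epsilon>\<close>, and the two differ by
    \<open>p + q - 1\<close>.\<close>
  have "p * q - \<epsilon> \<le> (1 - p) * (1 - q)" "(1 - p) * (1 - q) - \<epsilon> \<le> p * q"
    using k0 k1 x c d zero_le_power2[of "cmod (x - cnj c)"] zero_le_power2[of "cmod (x + cnj d)"]
    by linarith+
  then have "\<bar>p + q - 1\<bar> \<le> \<epsilon>" by (simp add: algebra_simps abs_le_iff)
  with p \<epsilon>s have q2: "\<bar>q - 1 / 2\<bar> \<le> 2 * s" by linarith
  have "p * (1 - p) \<le> (1 / 2)\<^sup>2"
    using zero_le_power2[of "p - 1 / 2"] by (simp add: power2_eq_square algebra_simps)
  with c have "(cmod c)\<^sup>2 \<le> (1 / 2)\<^sup>2" by linarith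
  then have c2: "cmod c \<le> 1 / 2" by (rule power2_le_imp_le) simp
  have "p * (1 - p) - (cmod c)\<^sup>2 \<le> \<epsilon>"
    using k0 x(2) zero_le_power2[of "cmod (x - cnj c)"] by linarith
  then have c4: "4 * (p * (1 - p) - \<epsilon>) \<le> 4 * (cmod c)\<^sup>2" by simp
  \<comment> \<open>As \<open>cmod c\<close> is at most 1/2, its double dominates
    \<open>4 |c|^2\<close>. Together with \<open>p * (1 - p) = 1/4 - (p - 1/2)^2\<close> this makes
    the gap of order \<open>\<epsilon>\<close>, so that its square root is still of order
    \<open>sqrt \<epsilon>\<close>.\<close>
  have "1 - 2 * cmod c \<le> 1 - 4 * (cmod c)\<^sup>2"
    using mult_left_mono[OF c2, of "cmod c"] by (simp add: power2_eq_square)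
  also have "\<dots> \<le> 1 - 4 * (p * (1 - p) - \<epsilon>)"
    using c4 by (rule diff_left_mono)
  also have "\<dots> = 4 * \<bar>p - 1 / 2\<bar>\<^sup>2 + 4 * \<epsilon>"
    by (simp add: power2_eq_square algebra_simps)
  also have "\<dots> \<le> 4 * \<epsilon>\<^sup>2 + 4 * \<epsilon>" using power_mono[OF p, of 2] by simp
  also have "\<dots> \<le> 8 * \<epsilon>" using mult_left_mono[OF \<epsilon>(2,1)] by (simp add: power2_eq_square)
  finally have gap: "1 - 2 * cmod c \<le> 8 * \<epsilon>" .
  have "c - cnj w / 2 = of_real (cmod c - 1 / 2) * cnj w"
    by (subst w(2)) (simp add: algebra_simps)
  then have "cmod (c - cnj w / 2) = \<bar>cmod c - 1 / 2\<bar>"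
    using w(1) by (simp only: norm_mult norm_of_real complex_mod_cnj) simp
  with gap c2 \<epsilon>s have cw: "cmod (c - cnj w / 2) \<le> 4 * s" by linarith
  have "cmod (cnj c - w / 2) = cmod (c - cnj w / 2)"
    using complex_mod_cnj[of "c - cnj w / 2"] by simp
  moreover have "cmod (x - w / 2) \<le> cmod (x - cnj c) + cmod (cnj c - w / 2)"
    using norm_triangle_ineq[of "x - cnj c" "cnj c - w / 2"] by simp
  ultimately have xw: "cmod (x - w / 2) \<le> 5 * s" using xc cw by linarith
  have "cmod (d + cnj w / 2) = cmod (cnj d + w / 2)"
    using complex_mod_cnj[of "d + cnj w / 2"] by simp
  moreover have "cmod (cnj d + w / 2) \<le> cmod (x + cnj d) + cmod (x - w / 2)"
    using norm_triangle_ineq4[of "x + cnj d" "x - w / 2"] by simp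
  ultimately have dw: "cmod (d + cnj w / 2) \<le> 6 * s" using xd xw by linarith
  have small: "cmod v \<le> 3 * s" if "(cmod v)\<^sup>2 \<le> (1 - 2 * cmod c) * r" "0 \<le> r" "r \<le> 1" for v :: complex and r
  proof -
    have "(1 - 2 * cmod c) * r \<le> 1 - 2 * cmod c"
      using that c2 mult_left_mono[of r 1 "1 - 2 * cmod c"] by simp
    \<comment> \<open>The gap \<open>8 * \<epsilon>\<close> is rounded up to the square
      \<open>9 * \<epsilon>\<close>.\<close>
    then have "(cmod v)\<^sup>2 \<le> (3 * s)\<^sup>2"
      using that gap \<epsilon> by (simp add: power_mult_distrib s)
    then show ?thesis by (rule power2_le_imp_le) (use s(1) in simp)
  qed
  have "cmod (x + w * y) \<le> 3 * s" using small[OF y[OF w]] q01 by simp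
  moreover have "w * (y + 1 / 2) = (x + w * y) - (x - w / 2)" by (simp add: algebra_simps)
  then have "cmod ((x + w * y) - (x - w / 2)) = cmod (w * (y + 1 / 2))" by (rule arg_cong[OF sym])
  then have "cmod (y + 1 / 2) = cmod ((x + w * y) - (x - w / 2))"
    unfolding norm_mult w(1) by simp
  ultimately have yw: "cmod (y + 1 / 2) \<le> 8 * s"
    using norm_triangle_ineq4[of "x + w * y" "x - w / 2"] xw by linarith
  have "cmod (z - w * x) \<le> 3 * s" using small[OF z[OF w]] q01 by simp
  moreover have "(z - w * x) + w * (x - w / 2) = z - w * w / 2" by (simp add: algebra_simps)
  with norm_triangle_ineq[of "z - w * x" "w * (x - w / 2)"]
  have "cmod (z - w * w / 2) \<le> cmod (z - w * x) + cmod (x - w / 2)"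
    unfolding norm_mult w(1) by simp
  ultimately have zw: "cmod (z - w * w / 2) \<le> 8 * s" using xw by linarith
  show thesis using that[of w] w(1) q2 cw dw xw yw zw by (simp add: s_def)
qed

section \<open>Trace preservation and two-step probabilities in coordinates\<close>

lemma sum_lessThan_4: "(\<Sum>i<4. f i) = f 0 + f 1 + f 2 + f (3 :: nat)"
  by (simp add: numeral_eq_Suc One_nat_def)

text \<open>A PSO is known to preserve the trace only on density matrices, and
  \<open>ketbra 2 0 1\<close> is not one; its trace is recovered by polarization.\<close>

lemma pso_trace_ketbra:
  assumes P: "pso 2 G"
  shows "mat_trace (G (ketbra 2 0 0)) = 1" "mat_trace (G (ketbra 2 1 1)) = 1"
    "mat_trace (G (ketbra 2 0 1)) = 0"
proof -
  have lin: "superoperator 2 G" using P by (simp add: pso_def)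
  define \<tau> where "\<tau> i j = mat_trace (G (ketbra 2 i j))" for i j
  have \<tau>: "of_real a * \<tau> 0 0 + b * \<tau> 0 1 + cnj b * \<tau> 1 0 + of_real d * \<tau> 1 1 = 1"
    if "a \<ge> 0" "d \<ge> 0" "(cmod b)\<^sup>2 \<le> a * d" "a + d = 1" for a b d
  proof -
    have "mat_trace (herm2 a b d) = 1"
      using that(4) by (simp add: mat_trace_2 flip: of_real_add)
    moreover have "psd 2 (herm2 a b d)" unfolding psd_2_iff using that by blast
    ultimately have "mat_trace (G (herm2 a b d)) = 1"
      using P unfolding pso_def density_def by blast
    then show ?thesis
      using superoperator_carrier[OF lin]
      by (simp add: mat_trace_2 index_superoperator_2[OF lin herm2_carrier] sum_lessThan_2 \<tau>_def
          algebra_simps)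
  qed
  have t: "\<tau> 0 0 = 1" "\<tau> 1 1 = 1" using \<tau>[of 1 0 0] \<tau>[of 0 1 0] by simp_all
  moreover have "\<tau> 0 1 = 0"
  proof -
    \<comment> \<open>The states with off-diagonal entry 1/2 and \<open>\<i> / 2\<close> make the
      sum and the difference of \<open>\<tau> 0 1\<close> and \<open>\<tau> 1 0\<close>
      vanish.\<close>
    have "1 / 2 + \<tau> 0 1 / 2 + \<tau> 1 0 / 2 + 1 / 2 = 1"
      using \<tau>[of "1 / 2" "1 / 2" "1 / 2"] t by (simp add: power2_eq_square)
    moreover have "1 / 2 + \<i> / 2 * \<tau> 0 1 - \<i> / 2 * \<tau> 1 0 + 1 / 2 = 1"
      using \<tau>[of "1 / 2" "1 / 2" "\<i> / 2"] t by (simp add: power2_eq_square norm_divide)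
    ultimately show ?thesis by (simp add: complex_eq_iff)
  qed
  ultimately show "mat_trace (G (ketbra 2 0 0)) = 1" "mat_trace (G (ketbra 2 1 1)) = 1"
    "mat_trace (G (ketbra 2 0 1)) = 0" by (simp_all add: \<tau>_def)
qed

lemma funpow_1_2: "(f ^^ 1) x = f x" "(f ^^ 2) x = f (f x)"
  by (simp_all add: One_nat_def numeral_2_eq_2)

lemma Pr0_iterate_2:
  assumes G: "superoperator 2 G"
  shows "Pr0 ((G ^^ 2) (ketbra 2 b b)) =
    Re (\<Sum>i<2. \<Sum>j<2. G (ketbra 2 b b) $$ (i, j) * G (ketbra 2 i j) $$ (0, 0))"
proof -
  have A: "G (ketbra 2 b b) \<in> carrier_mat 2 2"
    using superoperator_carrier[OF G ketbra_carrier] .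
  show ?thesis
    by (simp add: funpow_1_2 Pr0_index superoperator_carrier[OF G A] index_superoperator_2[OF G A])
qed

section \<open>The exact solutions\<close>

text \<open>For \<open>cmod w = 1\<close> this is the Hadamard gate conjugated by the phase gate
  \<open>diag(1, w)\<close>.\<close>

definition hadamard :: "complex \<Rightarrow> complex mat" where
  "hadamard w = mat 2 2 (\<lambda>(i, j). (if i = 0 then if j = 0 then 1 else cnj w
     else if j = 0 then w else - 1) / of_real (sqrt 2))"

lemma hadamard_carrier [simp]: "hadamard w \<in> carrier_mat 2 2"
  by (simp add: hadamard_def)

lemma conjugation_hadamard:
  assumes "i < 2" "j < 2" "r < 2" "s < 2"
  shows "conjugation (hadamard w) (ketbra 2 i j) $$ (r, s) =
    (if r = 0 then if i = 0 then 1 else cnj w else if i = 0 then w else - 1) *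
    (if s = 0 then if j = 0 then 1 else w else if j = 0 then cnj w else - 1) / 2"
proof -
  have "complex_of_real (sqrt 2) * complex_of_real (sqrt 2) = 2"
    by (metis of_real_mult of_real_numeral real_sqrt_mult_self abs_numeral)
  then show ?thesis
    unfolding conjugation_ketbra[OF hadamard_carrier assms] using assms by (auto simp: hadamard_def)
qed

abbreviation hadamard_eqs :: "exp_eq set" where
  "hadamard_eqs \<equiv> {Exp_Eq 1 0 (1/2), Exp_Eq 2 0 1, Exp_Eq 2 1 0}"

text \<open>The matrix is Hermitian and unitary, so applying its conjugation twice restores every
  state, while one application to the basis state 0 gives equal probabilities.\<close>

lemma hadamard_solution:
  assumes w: "cmod w = 1"
  shows "conjugation (hadamard w) \<in> solutions hadamard_eqs"
proof -
  have ww: "w * cnj w = 1" using w by (metis complex_norm_square of_real_1 one_power2)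
  have sq: "complex_of_real (sqrt 2) * complex_of_real (sqrt 2) = 2"
    by (metis of_real_mult of_real_numeral real_sqrt_mult_self abs_numeral)
  have "mat_adjoint (hadamard w) * hadamard w = 1\<^sub>m 2"
    by (rule mat_eq_2I)
      (auto simp: index_mult_2 sq ww mult.commute[of "cnj w" w] hadamard_def
        simp del: index_mult_mat intro: mult_carrier_mat[of _ 2 2 _ 2])
  then have "cpso 2 (conjugation (hadamard w))"
    by (intro cpso_conjugation) auto
  moreover have "eps_satisfies 0 (conjugation (hadamard w)) hadamard_eqs"
    using ww unfolding eps_satisfies_def
    by (simp add: Pr0_iterate_2[OF superoperator_conjugation[OF hadamard_carrier]]
        funpow_1_2(1) Pr0_index conjugation_carrier[OF hadamard_carrier ketbra_carrier] sum_lessThan_2 conjugation_hadamard mult.commute[of "cnj w" w])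
  ultimately show ?thesis by (simp add: solutions_def)
qed

section \<open>Coordinates of a one-qubit CPSO\<close>

text \<open>Trace preservation fixes the lower right entries, the Choi matrix being Hermitian
  relates the images of the two off-diagonal units, and its minors give the bounds on
  \<open>c\<close>, \<open>d\<close> and \<open>x\<close>. The last two bounds use Cauchy-Schwarz at
  a vector adapted to the phase of \<open>c\<close>.\<close>

lemma cpso_2_parameters:
  assumes G: "cpso 2 G"
  obtains p :: real and c :: complex and q :: real and d x y z :: complex
  where "G (ketbra 2 0 0) = herm2 p c (1 - p)" "G (ketbra 2 1 1) = herm2 q d (1 - q)"
    "\<forall>r<2. \<forall>s<2. G (ketbra 2 1 0) $$ (r, s) = cnj (G (ketbra 2 0 1) $$ (s, r))"
    "G (ketbra 2 0 1) $$ (0, 0) = x" "G (ketbra 2 0 1) $$ (0, 1) = y"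
    "G (ketbra 2 0 1) $$ (1, 0) = z" "G (ketbra 2 0 1) $$ (1, 1) = - x"
    "0 \<le> p" "p \<le> 1" "0 \<le> q" "q \<le> 1"
    "(cmod c)\<^sup>2 \<le> p * (1 - p)" "(cmod d)\<^sup>2 \<le> q * (1 - q)"
    "(cmod x)\<^sup>2 \<le> p * q" "(cmod x)\<^sup>2 \<le> (1 - p) * (1 - q)"
    "\<forall>w. cmod w = 1 \<longrightarrow> c = of_real (cmod c) * cnj w \<longrightarrow>
      (cmod (x + w * y))\<^sup>2 \<le> (1 - 2 * cmod c) * (1 - q)"
    "\<forall>w. cmod w = 1 \<longrightarrow> c = of_real (cmod c) * cnj w \<longrightarrow>
      (cmod (z - w * x))\<^sup>2 \<le> (1 - 2 * cmod c) * q"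
proof -
  have P: "pso 2 G" using pso_of_cpso_2[OF G] .
  have lin: "superoperator 2 G" using G by (simp add: cpso_def)
  have Gc: "G (ketbra 2 i j) \<in> carrier_mat 2 2" for i j
    using superoperator_carrier[OF lin ketbra_carrier] .
  define g where "g i j r s = G (ketbra 2 i j) $$ (r, s)" for i j r s
  have C: "psd 4 (choi 2 G)" using psd_choi[OF G] by simp
  have Cc: "choi 2 G \<in> carrier_mat 4 4" using psd_carrier[OF C] .
  have ch: "choi 2 G $$ (r * 2 + i, s * 2 + j) = g i j r s" if "i < 2" "j < 2" "r < 2" "s < 2" for i j r s
    using that mult_add_less[of r 2 i 2] mult_add_less[of s 2 j 2] by (simp add: choi_def g_def)
  have herm: "g j i s r = cnj (g i j r s)" if "i < 2" "j < 2" "r < 2" "s < 2" for i j r s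
    using psd_index_cnj[OF C, of "r * 2 + i" "s * 2 + j"] that
      mult_add_less[of r 2 i 2] mult_add_less[of s 2 j 2] by (simp add: ch)
  have diag: "g i i r r = of_real (Re (g i i r r))" "0 \<le> Re (g i i r r)" if "i < 2" "r < 2" for i r
    using psd_diag[OF C, of "r * 2 + i"] that mult_add_less[of r 2 i 2] by (simp_all add: ch)
  have minor: "(cmod (g i j r s))\<^sup>2 \<le> Re (g i i r r) * Re (g j j s s)"
    if "i < 2" "j < 2" "r < 2" "s < 2" for i j r s
    using psd_minor[OF C, of "r * 2 + i" "s * 2 + j"] that
      mult_add_less[of r 2 i 2] mult_add_less[of s 2 j 2] by (simp add: ch)
  define p q where pq: "p = Re (g 0 0 0 0)" "q = Re (g 1 1 0 0)"
  define c d where cd: "c = g 0 0 0 1" "d = g 1 1 0 1"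
  define x y z where xyz: "x = g 0 1 0 0" "y = g 0 1 0 1" "z = g 0 1 1 0"
  have tr: "g 0 0 0 0 + g 0 0 1 1 = 1" "g 1 1 0 0 + g 1 1 1 1 = 1" "g 0 1 0 0 + g 0 1 1 1 = 0"
    using pso_trace_ketbra[OF P] Gc by (simp_all add: mat_trace_2 g_def)
  have p': "Re (g 0 0 1 1) = 1 - p" and q': "Re (g 1 1 1 1) = 1 - q"
    using arg_cong[OF tr(1), of Re] arg_cong[OF tr(2), of Re] by (simp_all add: pq)
  have x': "g 0 1 1 1 = - x" using tr(3) by (simp add: xyz eq_neg_iff_add_eq_0 add.commute)
  have G0: "G (ketbra 2 0 0) = herm2 p c (1 - p)"
    using Gc diag(1)[of 0 0] diag(1)[of 0 1] herm[of 0 0 0 1]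
    by (intro mat_eq_2I) (simp_all add: p' flip: pq, simp_all add: g_def cd)
  have G1: "G (ketbra 2 1 1) = herm2 q d (1 - q)"
    using Gc diag(1)[of 1 0] diag(1)[of 1 1] herm[of 1 1 0 1]
    by (intro mat_eq_2I) (simp_all add: q' flip: pq, simp_all add: g_def cd)
  have CS: "(cmod (g 0 j 1 s - w * g 0 j 0 s))\<^sup>2 \<le> (1 - 2 * cmod c) * Re (g j j s s)"
    if w: "cmod w = 1" "c = of_real (cmod c) * cnj w" and js: "j < 2" "s < 2" for w j s
  proof -
    \<comment> \<open>Indices 0 and 2 stand for input 0 with output 0 and 1. On \<open>u\<close> the
      form is \<open>p - 2 Re (w * c) + (1 - p)\<close>, which is \<open>1 - 2 * cmod c\<close>
      because \<open>w\<close> cancels the phase of \<open>c\<close>.\<close>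
    define u where "u = vec 4 (\<lambda>i. if i = 2 then 1 else if i = 0 then - cnj w else 0 :: complex)"
    define v where "v = (unit_vec 4 (s * 2 + j) :: complex vec)"
    have sj: "s * 2 + j < 4" using mult_add_less[of s 2 j 2] js by simp
    have u: "u \<in> carrier_vec 4" and v: "v \<in> carrier_vec 4" by (simp_all add: u_def v_def)
    have ch': "choi 2 G $$ (0, s * 2 + j) = g 0 j 0 s" "choi 2 G $$ (2, s * 2 + j) = g 0 j 1 s"
      "choi 2 G $$ (0, 0) = g 0 0 0 0" "choi 2 G $$ (0, 2) = g 0 0 0 1"
      "choi 2 G $$ (2, 0) = g 0 0 1 0" "choi 2 G $$ (2, 2) = g 0 0 1 1"
      using ch[of 0 j 0 s] ch[of 0 j 1 s] ch[of 0 0 0 0] ch[of 0 0 0 1] ch[of 0 0 1 0] ch[of 0 0 1 1] js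
      by simp_all
    have "(choi 2 G *\<^sub>v v) \<bullet>c u = (\<Sum>i<4. choi 2 G $$ (i, s * 2 + j) * cnj (u $ i))"
    proof -
      have "(\<Sum>k<4. choi 2 G $$ (i, k) * v $ k * cnj (u $ i)) =
          (\<Sum>k<4. if k = s * 2 + j then choi 2 G $$ (i, s * 2 + j) * cnj (u $ i) else 0)" for i
        by (intro sum.cong refl) (auto simp: v_def unit_vec_def)
      then show ?thesis
        using sj by (simp add: cscalar_prod_mult_mat_vec_sum[OF Cc v u])
    qed
    also have "\<dots> = g 0 j 1 s - w * g 0 j 0 s"
      by (simp add: sum_lessThan_4 u_def ch')
    finally have vu: "(choi 2 G *\<^sub>v v) \<bullet>c u = g 0 j 1 s - w * g 0 j 0 s" .
    have ww: "w * cnj w = 1" using w(1) by (metis complex_norm_square of_real_1 one_power2)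
    have wc: "Re (w * c) = cmod c"
    proof -
      have "w * c = of_real (cmod c) * (w * cnj w)" by (subst w(2)) (simp add: mult_ac)
      then show ?thesis by (simp add: ww)
    qed
    have "(choi 2 G *\<^sub>v u) \<bullet>c u = g 0 0 0 0 * (w * cnj w) - w * c - cnj (w * c) + g 0 0 1 1"
      unfolding cscalar_prod_mult_mat_vec_sum[OF Cc u u]
      using herm[of 0 0 0 1] by (simp add: sum_lessThan_4 u_def ch' cd algebra_simps)
    then have "Re ((choi 2 G *\<^sub>v u) \<bullet>c u) = p - 2 * cmod c + (1 - p)"
      unfolding ww using wc p' by (simp add: pq)
    moreover have "(choi 2 G *\<^sub>v v) \<bullet>c v = g j j s s"
      using cscalar_prod_unit_vec[OF Cc sj sj] ch[OF js(1,1,2,2)] by (simp add: v_def)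
    ultimately show ?thesis
      using psd_Cauchy_Schwarz[OF C v u] unfolding vu by (simp add: mult.commute)
  qed
  show thesis
  proof (rule that[OF G0 G1])
    show "G (ketbra 2 0 1) $$ (0, 0) = x" "G (ketbra 2 0 1) $$ (0, 1) = y"
      "G (ketbra 2 0 1) $$ (1, 0) = z" "G (ketbra 2 0 1) $$ (1, 1) = - x"
      using x' by (simp_all add: xyz g_def)
    show "\<forall>r<2. \<forall>s<2. G (ketbra 2 1 0) $$ (r, s) = cnj (G (ketbra 2 0 1) $$ (s, r))"
      using herm[of 0 1] by (simp add: g_def)
    show "0 \<le> p" "p \<le> 1" "0 \<le> q" "q \<le> 1"
      using diag(2)[of 0 0] diag(2)[of 0 1] diag(2)[of 1 0] diag(2)[of 1 1] p' q' by (simp_all add: pq)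
    show "(cmod c)\<^sup>2 \<le> p * (1 - p)" "(cmod d)\<^sup>2 \<le> q * (1 - q)"
      using minor[of 0 0 0 1] minor[of 1 1 0 1] p' q' by (simp_all add: pq cd)
    show "(cmod x)\<^sup>2 \<le> p * q" "(cmod x)\<^sup>2 \<le> (1 - p) * (1 - q)"
      using minor[of 0 1 0 0] minor[of 0 1 1 1] p' q' x' by (simp_all add: pq xyz)
    have "(cmod (x + w * y))\<^sup>2 \<le> (1 - 2 * cmod c) * (1 - q)"
      if w: "cmod w = 1" "c = of_real (cmod c) * cnj w" for w
    proof -
      have "cmod (x + w * y) = cmod (- x - w * y)"
        using norm_minus_cancel[of "x + w * y"] by simp
      then show ?thesis using CS[OF w, of 1 1] q' x' by (simp add: xyz)
    qed
    then show "\<forall>w. cmod w = 1 \<longrightarrow> c = of_real (cmod c) * cnj w \<longrightarrow>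
      (cmod (x + w * y))\<^sup>2 \<le> (1 - 2 * cmod c) * (1 - q)" by blast
    have "(cmod (z - w * x))\<^sup>2 \<le> (1 - 2 * cmod c) * q"
      if w: "cmod w = 1" "c = of_real (cmod c) * cnj w" for w
      using CS[OF w, of 1 0] by (simp add: xyz pq)
    then show "\<forall>w. cmod w = 1 \<longrightarrow> c = of_real (cmod c) * cnj w \<longrightarrow>
      (cmod (z - w * x))\<^sup>2 \<le> (1 - 2 * cmod c) * q" by blast
  qed
qed

section \<open>Assembling the robustness bound\<close>

theorem theorem5:
  fixes \<epsilon> :: real
  assumes "0 \<le> \<epsilon>" and "\<epsilon> \<le> 1"
  shows "robust \<epsilon> (4579 * sqrt \<epsilon>) {Exp_Eq 1 0 (1/2), Exp_Eq 2 0 1, Exp_Eq 2 1 0}"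
  unfolding robust_def
proof (intro conjI allI impI)
  \<comment> \<open>The Hadamard gate itself, \<open>w = 1\<close>, is a solution.\<close>
  show "satisfiable hadamard_eqs"
    using hadamard_solution[of 1] unfolding satisfiable_def solutions_def by auto
  fix G assume "cpso 2 G \<and> eps_satisfies \<epsilon> G hadamard_eqs"
  then have G: "cpso 2 G" and E: "eps_satisfies \<epsilon> G hadamard_eqs" by auto
  have lin: "superoperator 2 G" using G by (simp add: cpso_def)
  obtain p c q d x y z where
    G0: "G (ketbra 2 0 0) = herm2 p c (1 - p)" and G1: "G (ketbra 2 1 1) = herm2 q d (1 - q)" and
    G10: "\<forall>r<2. \<forall>s<2. G (ketbra 2 1 0) $$ (r, s) = cnj (G (ketbra 2 0 1) $$ (s, r))" and
    G01: "G (ketbra 2 0 1) $$ (0, 0) = x" "G (ketbra 2 0 1) $$ (0, 1) = y"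
    "G (ketbra 2 0 1) $$ (1, 0) = z" "G (ketbra 2 0 1) $$ (1, 1) = - x" and
    p01: "0 \<le> p" "p \<le> 1" and q01: "0 \<le> q" "q \<le> 1" and
    cb: "(cmod c)\<^sup>2 \<le> p * (1 - p)" and db: "(cmod d)\<^sup>2 \<le> q * (1 - q)" and
    xb: "(cmod x)\<^sup>2 \<le> p * q" "(cmod x)\<^sup>2 \<le> (1 - p) * (1 - q)" and
    yb: "\<forall>w. cmod w = 1 \<longrightarrow> c = of_real (cmod c) * cnj w \<longrightarrow>
      (cmod (x + w * y))\<^sup>2 \<le> (1 - 2 * cmod c) * (1 - q)" and
    zb: "\<forall>w. cmod w = 1 \<longrightarrow> c = of_real (cmod c) * cnj w \<longrightarrow>
      (cmod (z - w * x))\<^sup>2 \<le> (1 - 2 * cmod c) * q"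
    by (rule cpso_2_parameters[OF G])
  have p\<epsilon>: "\<bar>p - 1 / 2\<bar> \<le> \<epsilon>"
    using E by (simp add: eps_satisfies_def funpow_1_2(1) Pr0_index G0)
  \<comment> \<open>The two off-diagonal terms are complex conjugates of each other and add up to
    twice a real part.\<close>
  have "Pr0 ((G ^^ 2) (ketbra 2 0 0)) = p\<^sup>2 + (1 - p) * q + 2 * Re (c * x)"
    "Pr0 ((G ^^ 2) (ketbra 2 1 1)) = q * p + (1 - q) * q + 2 * Re (d * x)"
    unfolding Pr0_iterate_2[OF lin]
    by (simp_all add: sum_lessThan_2 G0 G1 G10 G01 power2_eq_square)
  then have eqs: "p\<^sup>2 + (1 - p) * q + 2 * Re (c * x) \<ge> 1 - \<epsilon>"
    "q * p + (1 - q) * q + 2 * Re (d * x) \<le> \<epsilon>"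
    using E by (simp_all add: eps_satisfies_def abs_le_iff)
  obtain w where w: "cmod w = 1" and q: "\<bar>q - 1 / 2\<bar> \<le> 2 * sqrt \<epsilon>" and
    err: "cmod (c - cnj w / 2) \<le> 4 * sqrt \<epsilon>" "cmod (d + cnj w / 2) \<le> 6 * sqrt \<epsilon>"
    "cmod (x - w / 2) \<le> 5 * sqrt \<epsilon>" "cmod (y + 1 / 2) \<le> 8 * sqrt \<epsilon>"
    "cmod (z - w * w / 2) \<le> 8 * sqrt \<epsilon>"
    by (rule Hadamard_parameters[OF assms p\<epsilon> p01 q01 cb db xb eqs yb[rule_format] zb[rule_format]])
  define H where "H = conjugation (hadamard w)"
  have HE: "H \<in> solutions hadamard_eqs" using hadamard_solution[OF w] by (simp add: H_def)
  have linH: "superoperator 2 H'" if "H' \<in> solutions hadamard_eqs" for H'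
    using that by (simp add: solutions_def cpso_def)
  have ww: "w * cnj w = 1" using w by (metis complex_norm_square of_real_1 one_power2)
  have s: "0 \<le> sqrt \<epsilon>" using assms by simp
  have "\<epsilon> \<le> sqrt \<epsilon>" using assms by (simp add: real_le_rsqrt power2_eq_square mult_left_le)
  with p\<epsilon> have p: "\<bar>p - 1 / 2\<bar> \<le> sqrt \<epsilon>" by linarith
  have real_err: "cmod (of_real t - 1 / 2) = \<bar>t - 1 / 2\<bar>" for t
  proof -
    have "of_real t - 1 / 2 = complex_of_real (t - 1 / 2)" by simp
    then show ?thesis by (simp only: norm_of_real)
  qed
  let ?D = "\<lambda>i j r t. G (ketbra 2 i j) $$ (r, t) - H (ketbra 2 i j) $$ (r, t)"
  have D: "?D 0 0 0 0 = of_real p - 1 / 2" "?D 0 0 1 1 = - (of_real p - 1 / 2)"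
    "?D 0 0 0 1 = c - cnj w / 2" "?D 0 0 1 0 = cnj (c - cnj w / 2)"
    "?D 1 1 0 0 = of_real q - 1 / 2" "?D 1 1 1 1 = - (of_real q - 1 / 2)"
    "?D 1 1 0 1 = d + cnj w / 2" "?D 1 1 1 0 = cnj (d + cnj w / 2)"
    "?D 0 1 0 0 = x - w / 2" "?D 0 1 1 1 = - (x - w / 2)"
    "?D 0 1 0 1 = y + 1 / 2" "?D 0 1 1 0 = z - w * w / 2"
    "?D 1 0 0 0 = cnj (x - w / 2)" "?D 1 0 1 1 = - cnj (x - w / 2)"
    "?D 1 0 0 1 = cnj (z - w * w / 2)" "?D 1 0 1 0 = cnj (y + 1 / 2)"
    using ww by (simp_all add: H_def conjugation_hadamard G0 G1 G01 G10 mult.commute[of "cnj w" w])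
  have bounds: "cmod (of_real p - 1 / 2) \<le> 8 * sqrt \<epsilon>" "cmod (of_real q - 1 / 2) \<le> 8 * sqrt \<epsilon>"
    "cmod (c - cnj w / 2) \<le> 8 * sqrt \<epsilon>" "cmod (d + cnj w / 2) \<le> 8 * sqrt \<epsilon>"
    "cmod (x - w / 2) \<le> 8 * sqrt \<epsilon>"
    unfolding real_err using p q err(1-3) s by linarith+
  have "cmod ((G (ketbra 2 i j) - H (ketbra 2 i j)) $$ (r, t)) \<le> 8 * sqrt \<epsilon>"
    if "i < 2" "j < 2" "r < 2" "t < 2" for i j r t
  proof -
    have "i = 0 \<or> i = 1" "j = 0 \<or> j = 1" "r = 0 \<or> r = 1" "t = 0 \<or> t = 1" using that by auto
    then have "cmod (?D i j r t) \<le> 8 * sqrt \<epsilon>"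
      by (elim disjE; simp only: D norm_minus_cancel complex_mod_cnj bounds err(4,5))
    moreover have "H (ketbra 2 i j) \<in> carrier_mat 2 2"
      using superoperator_carrier[OF linH[OF HE] ketbra_carrier] .
    ultimately show ?thesis using that by simp
  qed
  \<comment> \<open>Factor 8 is the worst entry error, factor 6 the passage from entries to the
    superoperator norm.\<close>
  then have "superop_dist 2 G H \<le> 6 * (8 * sqrt \<epsilon>)"
    unfolding superop_dist_def by (intro superop_norm_le superoperator_diff lin linH HE)
  moreover have "superop_set_dist 2 G (solutions hadamard_eqs) \<le> superop_dist 2 G H"
    using superop_set_dist_le[OF lin HE linH] .
  ultimately show "superop_set_dist 2 G (solutions hadamard_eqs) \<le> 4579 * sqrt \<epsilon>"
    using s by linarith
qed (use assms in \<open>auto simp: valid_exp_eq_def\<close>)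

end
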